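(* For $k\in\mathcal{M}(W)$, the subspace $\boldsymbol{\mathcal{Q}}_{2k}(W)\otimes\mathbf{k}\subset R(T)_{\rm reg}\otimes\mathbf{k}[W]$ is stable under the action of the trigonometric Dunkl operators $$T^{\rm trig}_\xi\Bigl[\sum_{w\in W}f_w\otimes w\Bigr]=\sum_{w\in W}\Bigl(\partial_\xi f_w+\frac12\sum_{\alpha\in\mathcal{R}_+}k_\alpha\,\bar\alpha(\xi)\,\frac{1+e^{\bar\alpha}}{1-e^{\bar\alpha}}\,(f_w-s_\alpha f_{s_\alpha w})\Bigr)\otimes w,\qquad\xi\in\mathfrak{h},$$ and hence carries a left module structure over the trigonometric Cherednik algebra $\mathbf{H}^{\rm trig}_k(W)$ extending the natural $R(T)$-module structure on $\boldsymbol{\mathcal{Q}}_{2k}(W)\otimes\mathbf{k}$ defined via $f\mapsto\sum_{w\in W}f\otimes w$.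
   Context: $\mathbf{k}$ is a field of characteristic zero. $G$ is a compact connected Lie group with maximal torus $T$ and Weyl group $W$; $\hat T=\mathrm{Hom}(T,U(1))$, and $R(T)=\mathbb{Z}[\hat T]$ is the representation ring, with elements $e^\lambda$, $\lambda\in\hat T$. $\mathcal{R}_+\subset\hat T$ is a set of positive roots, $s_\alpha\in W$ the reflection in $\alpha$. For $\alpha\in\mathcal{R}_+$ put $\bar\alpha=\frac\alpha2$ if $\frac\alpha2\in\hat T$ and $\bar\alpha=\alpha$ otherwise. $\mathcal{M}(W)$ is the set of $W$-invariant functions $k$ assigning to each $\alpha\in\mathcal{R}_+$ (each reflection hyperplane) an integer $k_\alpha\ge0$. $\mathfrak{h}=\mathrm{Hom}_{\mathbb{Z}}(\hat T,\mathbf{k})$, so that $\hat T\subset\mathfrak{h}^*$. $\boldsymbol{\mathcal{Q}}_{2k}(W)=\{\sum_wp_w\otimes w\in R(T)\otimes\mathbb{Z}[W]: p_{s_\alpha w}\equiv p_w\bmod\langle(1-e^{\bar\alpha})^{2k_\alpha}\rangle\ \forall\alpha\in\mathcal{R}_+,\ w\in W\}$. $R(T)_{\rm reg}=R(T)[(1-e^\alpha)^{-1}:\alpha\in\mathcal{R}_+]$. For $\xi\in\mathfrak{h}$, $\partial_\xi$ is the first-order differential operator (derivation) with $\partial_\xi(e^\nu)=\nu(\xi)e^\nu$ for $\nu\in\hat T$, acting on the first factor of $R(T)_{\rm reg}\otimes\mathbf{k}[W]$. The trigonometric double affine Hecke (Cherednik) algebra $\mathbf{H}^{\rm trig}_k(W)$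 is the $\mathbf{k}$-subalgebra of $\mathrm{End}_{\mathbf{k}}(R(T)_{\rm reg}\otimes\mathbf{k}[W])$ generated by the elements of $R(T)$ (multiplication on the first factor), the elements of $W$ (acting diagonally, $g\cdot(f\otimes w)=g(f)\otimes gw$) and the operators $T^{\rm trig}_\xi=\partial_\xi+\frac12\sum_{\alpha\in\mathcal{R}_+}k_\alpha\,\bar\alpha(\xi)\,\frac{1+e^{\bar\alpha}}{1-e^{\bar\alpha}}(1-s_\alpha)$, $\xi\in\mathfrak{h}$, whose explicit action is the displayed formula. *)

theory Defs
  imports
    "HOL-Library.Poly_Mapping"
    "HOL-Library.Function_Algebras"
    "HOL-Library.FuncSet"
    Complex_Main
begin

section \<open>Total rings of fractions\<close>

definition non_zero_divisor :: "'a::comm_ring_1 \<Rightarrow> bool" where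
  "non_zero_divisor s \<longleftrightarrow> (\<forall>a. a * s = 0 \<longrightarrow> a = 0)"

lemma non_zero_divisor_1 [simp]: "non_zero_divisor 1"
  by (simp add: non_zero_divisor_def)

lemma non_zero_divisor_mult [simp]:
  "non_zero_divisor s \<Longrightarrow> non_zero_divisor t \<Longrightarrow> non_zero_divisor (s * t)"
  by (metis mult.assoc non_zero_divisor_def)

lemma non_zero_divisor_cancel:
  assumes "non_zero_divisor s" "a * s = b * s"
  shows "a = b"
proof -
  have "(a - b) * s = 0" using assms(2) by (simp add: algebra_simps)
  then show ?thesis using assms(1) unfolding non_zero_divisor_def
    by (metis eq_iff_diff_eq_0)
qed

definition tfrac_rel :: "'a::comm_ring_1 \<times> 'a \<Rightarrow> 'a \<times> 'a \<Rightarrow> bool" where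
  "tfrac_rel x y \<longleftrightarrow> non_zero_divisor (snd x) \<and> non_zero_divisor (snd y) \<and>
     fst x * snd y = fst y * snd x"

lemma part_equivp_tfrac_rel:
  "part_equivp (tfrac_rel :: 'a::comm_ring_1 \<times> 'a \<Rightarrow> _)" (is "part_equivp ?R")
proof (rule part_equivpI)
  show "\<exists>x. ?R x x"
    by (rule exI[where x = "(0, 1)"]) (simp add: tfrac_rel_def)
  show "symp ?R"
    by (auto simp: symp_def tfrac_rel_def)
  show "transp ?R"
  proof (rule transpI)
    fix x y z :: "'a \<times> 'a"
    assume xy: "tfrac_rel x y" and yz: "tfrac_rel y z"
    have "(fst x * snd z) * snd y = (fst x * snd y) * snd z" by (simp add: ac_simps)
    also have "\<dots> = (fst y * snd z) * snd x" using xy by (simp add: tfrac_rel_def ac_simps)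
    also have "\<dots> = (fst z * snd x) * snd y" using yz by (simp add: tfrac_rel_def ac_simps)
    finally have "fst x * snd z = fst z * snd x"
      using xy non_zero_divisor_cancel[of "snd y"] by (simp add: tfrac_rel_def)
    then show "tfrac_rel x z" using xy yz by (simp add: tfrac_rel_def)
  qed
qed

quotient_type (overloaded) 'a tfrac = "'a::comm_ring_1 \<times> 'a" / partial: tfrac_rel
  by (rule part_equivp_tfrac_rel)

text \<open>\<open>Frac a s\<close> is \<open>a / s\<close>, with the junk value \<open>0\<close> when \<open>s\<close> is a zero divisor.\<close>

lift_definition Frac :: "'a::comm_ring_1 \<Rightarrow> 'a \<Rightarrow> 'a tfrac"
  is "\<lambda>a s. if non_zero_divisor s then (a, s) else (0, 1)"
  by (simp add: tfrac_rel_def)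

lemma Frac_cases [cases type: tfrac]:
  obtains (Frac) a s where "x = Frac a s" "non_zero_divisor s"
  by transfer (force simp: tfrac_rel_def)

lemma Frac_eq_iff:
  "non_zero_divisor s \<Longrightarrow> non_zero_divisor t \<Longrightarrow> Frac a s = Frac b t \<longleftrightarrow> a * t = b * s"
  by transfer (simp add: tfrac_rel_def)

instantiation tfrac :: (comm_ring_1) comm_ring_1
begin

lift_definition zero_tfrac :: "'a tfrac" is "(0, 1)"
  by (simp add: tfrac_rel_def)

lift_definition one_tfrac :: "'a tfrac" is "(1, 1)"
  by (simp add: tfrac_rel_def)

lift_definition plus_tfrac :: "'a tfrac \<Rightarrow> 'a tfrac \<Rightarrow> 'a tfrac"
  is "\<lambda>x y. (fst x * snd y + fst y * snd x, snd x * snd y)"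
proof -
  fix x x' y y' :: "'a \<times> 'a"
  assume x: "tfrac_rel x x'" and y: "tfrac_rel y y'"
  have "(fst x * snd y + fst y * snd x) * (snd x' * snd y') =
      (fst x * snd x') * (snd y * snd y') + (fst y * snd y') * (snd x * snd x')"
    by (simp add: algebra_simps)
  also have "\<dots> = (fst x' * snd x) * (snd y * snd y') + (fst y' * snd y) * (snd x * snd x')"
    using x y by (simp add: tfrac_rel_def)
  also have "\<dots> = (fst x' * snd y' + fst y' * snd x') * (snd x * snd y)"
    by (simp add: algebra_simps)
  finally show "tfrac_rel (fst x * snd y + fst y * snd x, snd x * snd y)
      (fst x' * snd y' + fst y' * snd x', snd x' * snd y')"
    using x y by (simp add: tfrac_rel_def)
qed

lift_definition uminus_tfrac :: "'a tfrac \<Rightarrow> 'a tfrac" is "\<lambda>x. (- fst x, snd x)"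
  by (simp add: tfrac_rel_def)

definition minus_tfrac :: "'a tfrac \<Rightarrow> 'a tfrac \<Rightarrow> 'a tfrac"
  where "minus_tfrac x y = x + (- y)"

lift_definition times_tfrac :: "'a tfrac \<Rightarrow> 'a tfrac \<Rightarrow> 'a tfrac"
  is "\<lambda>x y. (fst x * fst y, snd x * snd y)"
proof -
  fix x x' y y' :: "'a \<times> 'a"
  assume x: "tfrac_rel x x'" and y: "tfrac_rel y y'"
  have "(fst x * fst y) * (snd x' * snd y') = (fst x * snd x') * (fst y * snd y')"
    by (simp add: ac_simps)
  also have "\<dots> = (fst x' * snd x) * (fst y' * snd y)"
    using x y by (simp add: tfrac_rel_def)
  also have "\<dots> = (fst x' * fst y') * (snd x * snd y)"
    by (simp add: ac_simps)
  finally show "tfrac_rel (fst x * fst y, snd x * snd y) (fst x' * fst y', snd x' * snd y')"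
    using x y by (simp add: tfrac_rel_def)
qed

instance
proof
  fix x y z :: "'a tfrac"
  show "x * y * z = x * (y * z)" by transfer (simp add: tfrac_rel_def ac_simps)
  show "x * y = y * x" by transfer (simp add: tfrac_rel_def ac_simps)
  show "1 * x = x" by transfer (simp add: tfrac_rel_def)
  show "x + y + z = x + (y + z)" by transfer (simp add: tfrac_rel_def algebra_simps)
  show "x + y = y + x" by transfer (simp add: tfrac_rel_def algebra_simps)
  show "0 + x = x" by transfer (simp add: tfrac_rel_def)
  show "- x + x = 0" by transfer (simp add: tfrac_rel_def algebra_simps)
  show "x - y = x + - y" by (simp add: minus_tfrac_def)
  show "(x + y) * z = x * z + y * z" by transfer (simp add: tfrac_rel_def algebra_simps)
  show "(0::'a tfrac) \<noteq> 1" by transfer (simp add: tfrac_rel_def)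
qed

end

lemma Frac_add:
  "non_zero_divisor s \<Longrightarrow> non_zero_divisor t \<Longrightarrow>
     Frac a s + Frac b t = Frac (a * t + b * s) (s * t)"
  by transfer (simp add: tfrac_rel_def)

lemma Frac_mult:
  "non_zero_divisor s \<Longrightarrow> non_zero_divisor t \<Longrightarrow> Frac a s * Frac b t = Frac (a * b) (s * t)"
  by transfer (simp add: tfrac_rel_def)

lemma Frac_0: "Frac 0 1 = 0" and Frac_1: "Frac 1 1 = 1"
  by (transfer; simp add: tfrac_rel_def)+

text \<open>The unique extensions of a ring automorphism and of a derivation to fractions; the two
  lemmas following the definitions show that the descriptions are well-defined.\<close>

definition tfrac_aut :: "('a::comm_ring_1 \<Rightarrow> 'a) \<Rightarrow> 'a tfrac \<Rightarrow> 'a tfrac" where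
  "tfrac_aut \<phi> x = (THE y. \<forall>a s. non_zero_divisor s \<and> x = Frac a s \<longrightarrow> y = Frac (\<phi> a) (\<phi> s))"

definition tfrac_deriv :: "('a::comm_ring_1 \<Rightarrow> 'a) \<Rightarrow> 'a tfrac \<Rightarrow> 'a tfrac" where
  "tfrac_deriv D x =
     (THE y. \<forall>a s. non_zero_divisor s \<and> x = Frac a s \<longrightarrow> y = Frac (D a * s - a * D s) (s * s))"

lemma tfrac_aut_Frac:
  assumes bij: "bij \<phi>" and mult: "\<And>a b. \<phi> (a * b) = \<phi> a * \<phi> b" and add: "\<And>a b. \<phi> (a + b) = \<phi> a + \<phi> b"
    and s: "non_zero_divisor s"
  shows "tfrac_aut \<phi> (Frac a s) = Frac (\<phi> a) (\<phi> s)"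
proof -
  have zero: "\<phi> 0 = 0" using add[of 0 0] by simp
  have nzd: "non_zero_divisor (\<phi> t)" if "non_zero_divisor t" for t
    unfolding non_zero_divisor_def
  proof (intro allI impI)
    fix c assume "c * \<phi> t = 0"
    moreover obtain b where b: "c = \<phi> b" using bij by (metis bij_pointE)
    ultimately have "\<phi> (b * t) = \<phi> 0" by (simp add: mult zero)
    then have "b * t = 0" using bij by (metis bij_pointE)
    then have "b = 0" using that by (simp add: non_zero_divisor_def)
    then show "c = 0" using b zero by simp
  qed
  have wd: "Frac (\<phi> a) (\<phi> s) = Frac (\<phi> b) (\<phi> t)"
    if "non_zero_divisor t" "Frac a s = Frac b t" for b t
    using that s nzd by (simp add: Frac_eq_iff flip: mult)
  show ?thesis unfolding tfrac_aut_def
  proof (rule the_equality)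
    show "\<forall>b t. non_zero_divisor t \<and> Frac a s = Frac b t \<longrightarrow> Frac (\<phi> a) (\<phi> s) = Frac (\<phi> b) (\<phi> t)"
      using wd by blast
  qed (use s in blast)
qed

lemma tfrac_deriv_Frac:
  assumes add: "\<And>a b. D (a + b) = D a + D b" and Leibniz: "\<And>a b. D (a * b) = D a * b + a * D b"
    and s: "non_zero_divisor s"
  shows "tfrac_deriv D (Frac a s) = Frac (D a * s - a * D s) (s * s)"
proof -
  have wd: "Frac (D a * s - a * D s) (s * s) = Frac (D b * t - b * D t) (t * t)"
    if t: "non_zero_divisor t" and eq: "Frac a s = Frac b t" for b t
  proof -
    have e: "a * t = b * s" using s t eq by (simp add: Frac_eq_iff)
    then have "D a * t + a * D t = D b * s + b * D s" by (metis Leibniz)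
    then have d: "D a * t = D b * s + b * D s - a * D t" by (simp add: algebra_simps)
    have "(D a * s - a * D s) * (t * t) = (D a * t) * (s * t) - (a * t) * D s * t"
      by (simp add: algebra_simps)
    also have "\<dots> = (D b * s + b * D s - a * D t) * (s * t) - (b * s) * D s * t"
      by (simp add: d e)
    also have "\<dots> = D b * s * s * t - (a * t) * D t * s"
      by (simp add: algebra_simps)
    also have "\<dots> = (D b * t - b * D t) * (s * s)"
      by (simp add: e algebra_simps)
    finally show ?thesis using s t by (simp add: Frac_eq_iff)
  qed
  show ?thesis unfolding tfrac_deriv_def
  proof (rule the_equality)
    show "\<forall>b t. non_zero_divisor t \<and> Frac a s = Frac b t \<longrightarrow>
        Frac (D a * s - a * D s) (s * s) = Frac (D b * t - b * D t) (t * t)"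
      using wd by blast
  qed (use s in blast)
qed


section \<open>Root data\<close>

text \<open>Every abelian group is a \<open>\<int>\<close>-module in a unique way.\<close>

definition zscale :: "int \<Rightarrow> 'x::ab_group_add \<Rightarrow> 'x" where
  "zscale n x = (\<Sum>i<nat n. x) - (\<Sum>i<nat (- n). x)"

lemma zscale_diff: "zscale (int a - int b) x = (\<Sum>i<a. x) - (\<Sum>i<b. x)"
proof -
  have plus: "(\<Sum>i<m + n. x) = (\<Sum>i<m. x) + (\<Sum>i<n. x)" for m n :: nat
    by (induction n) (simp_all add: algebra_simps)
  show ?thesis
  proof (cases "a \<le> b")
    case True
    then obtain c where "b = a + c" using le_Suc_ex by blast
    then show ?thesis by (simp add: zscale_def plus)
  next
    case False
    then obtain c where "a = b + c" using le_Suc_ex nat_le_linear by blast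
    then show ?thesis by (simp add: zscale_def plus)
  qed
qed

lemma module_zscale: "module zscale"
proof -
  have plus: "(\<Sum>i<m + n. x) = (\<Sum>i<m. x) + (\<Sum>i<n. x)" for m n :: nat and x :: 'a
    by (induction n) (simp_all add: algebra_simps)
  have right: "zscale n (x + y) = zscale n x + zscale n y" for n and x y :: 'a
    by (simp add: zscale_def sum.distrib)
  have left: "zscale (m + n) x = zscale m x + zscale n x" for m n and x :: 'a
  proof -
    obtain a b c d where "m = int a - int b" "n = int c - int d" by (metis int_diff_cases)
    moreover from this have "m + n = int (a + c) - int (b + d)" by simp
    ultimately show ?thesis by (simp only: zscale_diff plus) simp
  qed
  have one: "zscale 1 x = x" for x :: 'a by (simp add: zscale_def)
  have neg: "zscale (- n) x = - zscale n x" for n and x :: 'a by (simp add: zscale_def)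
  have zero: "zscale 0 x = 0" for x :: 'a by (simp add: zscale_def)
  have nat: "zscale (int a) (zscale n x) = zscale (int a * n) x" for a n and x :: 'a
    by (induction a) (simp_all add: zero left one algebra_simps)
  have "zscale m (zscale n x) = zscale (m * n) x" for m n and x :: 'a
    by (cases m rule: int_cases2) (simp_all add: nat neg)
  then show ?thesis by (simp add: module_def right left one)
qed

definition reflection :: "('x::ab_group_add \<Rightarrow> 'x \<Rightarrow> int) \<Rightarrow> 'x \<Rightarrow> 'x \<Rightarrow> 'x" where
  "reflection cor \<alpha> x = x - zscale (cor \<alpha> x) \<alpha>"

text \<open>A compact connected Lie group \<open>G\<close> with maximal torus \<open>T\<close> is encoded by its root datum:
  the type \<open>'x\<close> is the character lattice \<open>Hom(T, U(1))\<close> (written additively), \<open>R\<close> is the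
  set of roots and \<open>cor \<alpha>\<close> is the coroot of \<open>\<alpha>\<close>, viewed as the functional
  \<open>x \<mapsto> \<langle>x, \<alpha>\<^sup>\<or>\<rangle>\<close> on the character lattice.  The reduced root data are, up to isomorphism,
  exactly those of the pairs \<open>(G, T)\<close>.  The axiom \<open>cor_reflection\<close> is
  \<open>(s\<^sub>\<alpha> \<beta>)\<^sup>\<or> = s\<^sub>\<alpha>(\<beta>\<^sup>\<or>)\<close>, the stability of the set of coroots.\<close>

locale root_datum =
  fixes R :: "'x::ab_group_add set" and cor :: "'x \<Rightarrow> 'x \<Rightarrow> int"
  assumes lattice: "\<exists>B :: 'x set. finite B \<and> \<not> module.dependent zscale B \<and> module.span zscale B = UNIV"
    and finite_roots: "finite R"
    and additive_cor: "\<alpha> \<in> R \<Longrightarrow> additive (cor \<alpha>)"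
    and cor_self: "\<alpha> \<in> R \<Longrightarrow> cor \<alpha> \<alpha> = 2"
    and reflection_root: "\<alpha> \<in> R \<Longrightarrow> \<beta> \<in> R \<Longrightarrow> reflection cor \<alpha> \<beta> \<in> R"
    and cor_reflection: "\<alpha> \<in> R \<Longrightarrow> \<beta> \<in> R \<Longrightarrow>
      cor (reflection cor \<alpha> \<beta>) x = cor \<beta> (reflection cor \<alpha> x)"
    and reduced: "\<alpha> \<in> R \<Longrightarrow> \<alpha> + \<alpha> \<notin> R"

text \<open>The Weyl group \<open>N(T)/T\<close>, as the group of automorphisms of the character lattice generated
  by the reflections.\<close>

inductive_set weyl_group :: "'x::ab_group_add set \<Rightarrow> ('x \<Rightarrow> 'x \<Rightarrow> int) \<Rightarrow> ('x \<Rightarrow> 'x) set"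
  for R :: "'x::ab_group_add set" and cor :: "'x \<Rightarrow> 'x \<Rightarrow> int" where
  weyl_id: "id \<in> weyl_group R cor"
| weyl_reflection: "\<alpha> \<in> R \<Longrightarrow> w \<in> weyl_group R cor \<Longrightarrow> reflection cor \<alpha> \<circ> w \<in> weyl_group R cor"

definition positive_roots :: "'x::ab_group_add set \<Rightarrow> 'x set \<Rightarrow> bool" where
  "positive_roots R P \<longleftrightarrow>
     (\<exists>l :: 'x \<Rightarrow> real. additive l \<and> (\<forall>\<alpha>\<in>R. l \<alpha> \<noteq> 0) \<and> P = {\<alpha> \<in> R. l \<alpha> > 0})"

text \<open>A positive root stands for its reflection hyperplane, so invariance is tested up to sign.
  The values of \<open>k\<close> outside \<open>P\<close> are irrelevant.\<close>

definition weyl_invariant ::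
    "'x::ab_group_add set \<Rightarrow> ('x \<Rightarrow> 'x \<Rightarrow> int) \<Rightarrow> 'x set \<Rightarrow> ('x \<Rightarrow> nat) \<Rightarrow> bool" where
  "weyl_invariant R cor P k \<longleftrightarrow>
     (\<forall>w\<in>weyl_group R cor. \<forall>\<alpha>\<in>P. \<forall>\<beta>\<in>P. w \<alpha> = \<beta> \<or> w \<alpha> = - \<beta> \<longrightarrow> k \<alpha> = k \<beta>)"

definition bar :: "'x::ab_group_add \<Rightarrow> 'x" where
  "bar \<alpha> = (if \<exists>\<mu>. \<mu> + \<mu> = \<alpha> then (THE \<mu>. \<mu> + \<mu> = \<alpha>) else \<alpha>)"


section \<open>Quasi-invariants\<close>

text \<open>\<open>R(T)\<close> is the group ring \<open>'x \<Rightarrow>\<^sub>0 int\<close> and \<open>R(T) \<otimes> k\<close> is \<open>'x \<Rightarrow>\<^sub>0 'k\<close>.\<close>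

abbreviation gexp :: "'x::ab_group_add \<Rightarrow> 'x \<Rightarrow>\<^sub>0 'c::comm_ring_1" where
  "gexp x \<equiv> Poly_Mapping.single x 1"

text \<open>An element \<open>\<Sum> p\<^sub>w \<otimes> w\<close> of \<open>A \<otimes> \<int>[W]\<close> is the function \<open>w \<mapsto> p\<^sub>w\<close> vanishing
  outside \<open>W\<close>.\<close>

definition quasi_invariants ::
    "'x::ab_group_add set \<Rightarrow> ('x \<Rightarrow> 'x \<Rightarrow> int) \<Rightarrow> 'x set \<Rightarrow> ('x \<Rightarrow> nat) \<Rightarrow>
     (('x \<Rightarrow> 'x) \<Rightarrow> 'x \<Rightarrow>\<^sub>0 int) set" where
  "quasi_invariants R cor P k =
     {p. (\<forall>w. w \<notin> weyl_group R cor \<longrightarrow> p w = 0) \<and>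
         (\<forall>\<alpha>\<in>P. \<forall>w\<in>weyl_group R cor.
            (1 - gexp (bar \<alpha>)) ^ (2 * k \<alpha>) dvd p (reflection cor \<alpha> \<circ> w) - p w)}"

definition const_family ::
    "'x::ab_group_add set \<Rightarrow> ('x \<Rightarrow> 'x \<Rightarrow> int) \<Rightarrow> ('x \<Rightarrow>\<^sub>0 int) \<Rightarrow> ('x \<Rightarrow> 'x) \<Rightarrow> 'x \<Rightarrow>\<^sub>0 int" where
  "const_family R cor f = (\<lambda>w. if w \<in> weyl_group R cor then f else 0)"


section \<open>The localised module\<close>

text \<open>\<open>R(T)\<^sub>r\<^sub>e\<^sub>g \<otimes> k\<close>, inside the total ring of fractions of \<open>R(T) \<otimes> k\<close>.  The
  denominators are not zero divisors, because the character lattice is torsion-free and roots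
  are nonzero.\<close>

definition regular_ring :: "'x::ab_group_add set \<Rightarrow> ('x \<Rightarrow>\<^sub>0 'k::field_char_0) tfrac set" where
  "regular_ring P = {Frac a (\<Prod>\<alpha>\<in>P. (1 - gexp \<alpha>) ^ n \<alpha>) | a n. True}"

text \<open>\<open>R(T)\<^sub>r\<^sub>e\<^sub>g \<otimes> k[W]\<close>\<close>

definition regular_module ::
    "'x::ab_group_add set \<Rightarrow> ('x \<Rightarrow> 'x \<Rightarrow> int) \<Rightarrow> 'x set \<Rightarrow>
     (('x \<Rightarrow> 'x) \<Rightarrow> ('x \<Rightarrow>\<^sub>0 'k::field_char_0) tfrac) set" where
  "regular_module R cor P =
     {f. (\<forall>w\<in>weyl_group R cor. f w \<in> regular_ring P) \<and> (\<forall>w. w \<notin> weyl_group R cor \<longrightarrow> f w = 0)}"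

definition scalar :: "'k::field_char_0 \<Rightarrow> ('x::ab_group_add \<Rightarrow>\<^sub>0 'k) tfrac" where
  "scalar c = Frac (Poly_Mapping.single 0 c) 1"

definition kscale ::
    "'k::field_char_0 \<Rightarrow> ('w \<Rightarrow> ('x::ab_group_add \<Rightarrow>\<^sub>0 'k) tfrac) \<Rightarrow> 'w \<Rightarrow> ('x \<Rightarrow>\<^sub>0 'k) tfrac" where
  "kscale c f = (\<lambda>w. scalar c * f w)"

lemma module_kscale:
  "module (kscale :: 'k::field_char_0 \<Rightarrow> ('w \<Rightarrow> ('x::ab_group_add \<Rightarrow>\<^sub>0 'k) tfrac) \<Rightarrow> _)"
proof -
  have "(scalar (a + b) :: ('x \<Rightarrow>\<^sub>0 'k) tfrac) = scalar a + scalar b" for a b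
    by (simp add: scalar_def Frac_add single_add)
  moreover have "(scalar (a * b) :: ('x \<Rightarrow>\<^sub>0 'k) tfrac) = scalar a * scalar b" for a b
    by (simp add: scalar_def Frac_mult mult_single)
  moreover have "(scalar 1 :: ('x \<Rightarrow>\<^sub>0 'k) tfrac) = 1"
    by (simp add: scalar_def flip: Frac_1 single_one)
  ultimately show ?thesis
    by (simp add: module_def kscale_def fun_eq_iff algebra_simps)
qed

definition incl :: "('x::ab_group_add \<Rightarrow>\<^sub>0 int) \<Rightarrow> ('x \<Rightarrow>\<^sub>0 'k::field_char_0) tfrac" where
  "incl p = Frac (Poly_Mapping.map of_int p) 1"

text \<open>The image of \<open>Q\<^sub>2\<^sub>k(W) \<otimes> k\<close> in \<open>R(T)\<^sub>r\<^sub>e\<^sub>g \<otimes> k[W]\<close>.\<close>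

definition quasi_invariants_k ::
    "'x::ab_group_add set \<Rightarrow> ('x \<Rightarrow> 'x \<Rightarrow> int) \<Rightarrow> 'x set \<Rightarrow> ('x \<Rightarrow> nat) \<Rightarrow>
     (('x \<Rightarrow> 'x) \<Rightarrow> ('x \<Rightarrow>\<^sub>0 'k::field_char_0) tfrac) set" where
  "quasi_invariants_k R cor P k =
     module.span kscale ((\<lambda>p. incl \<circ> p) ` quasi_invariants R cor P k)"


section \<open>Operators on the localised module\<close>

definition lattice_act :: "('x \<Rightarrow> 'x) \<Rightarrow> ('x::ab_group_add \<Rightarrow>\<^sub>0 'k::field_char_0) \<Rightarrow> 'x \<Rightarrow>\<^sub>0 'k" where
  "lattice_act g p =
     (\<Sum>x\<in>Poly_Mapping.keys p. Poly_Mapping.single (g x) (Poly_Mapping.lookup p x))"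

definition lattice_deriv :: "('x \<Rightarrow> 'k) \<Rightarrow> ('x::ab_group_add \<Rightarrow>\<^sub>0 'k::field_char_0) \<Rightarrow> 'x \<Rightarrow>\<^sub>0 'k" where
  "lattice_deriv \<xi> p =
     (\<Sum>x\<in>Poly_Mapping.keys p. Poly_Mapping.single x (\<xi> x * Poly_Mapping.lookup p x))"

lemma lattice_act_superset:
  assumes "finite A" "Poly_Mapping.keys p \<subseteq> A"
  shows "lattice_act g p = (\<Sum>x\<in>A. Poly_Mapping.single (g x) (Poly_Mapping.lookup p x))"
  unfolding lattice_act_def using assms
  by (intro sum.mono_neutral_left) (auto simp: in_keys_iff)

lemma lattice_deriv_superset:
  assumes "finite A" "Poly_Mapping.keys p \<subseteq> A"
  shows "lattice_deriv \<xi> p = (\<Sum>x\<in>A. Poly_Mapping.single x (\<xi> x * Poly_Mapping.lookup p x))"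
  unfolding lattice_deriv_def using assms
  by (intro sum.mono_neutral_left) (auto simp: in_keys_iff)

lemma lattice_act_single: "lattice_act g (Poly_Mapping.single x c) = Poly_Mapping.single (g x) c"
  by (subst lattice_act_superset[of "{x}"]) (auto simp: lookup_single)

lemma lattice_deriv_single:
  "lattice_deriv \<xi> (Poly_Mapping.single x c) = Poly_Mapping.single x (\<xi> x * c)"
  by (subst lattice_deriv_superset[of "{x}"]) (auto simp: lookup_single)

lemma lattice_act_add: "lattice_act g (p + q) = lattice_act g p + lattice_act g q"
proof -
  let ?A = "Poly_Mapping.keys p \<union> Poly_Mapping.keys q"
  have "Poly_Mapping.keys (p + q) \<subseteq> ?A" by (rule Poly_Mapping.keys_add)
  then show ?thesis
    by (simp add: lattice_act_superset[of ?A] lookup_add single_add sum.distrib)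
qed

lemma lattice_deriv_add: "lattice_deriv \<xi> (p + q) = lattice_deriv \<xi> p + lattice_deriv \<xi> q"
proof -
  let ?A = "Poly_Mapping.keys p \<union> Poly_Mapping.keys q"
  have "Poly_Mapping.keys (p + q) \<subseteq> ?A" by (rule Poly_Mapping.keys_add)
  then show ?thesis
    by (simp add: lattice_deriv_superset[of ?A] lookup_add single_add sum.distrib distrib_left)
qed

lemma sum_monomials:
  "(\<Sum>x\<in>Poly_Mapping.keys p. Poly_Mapping.single x (Poly_Mapping.lookup p x)) = p"
proof (rule poly_mapping_eqI)
  fix y
  show "Poly_Mapping.lookup
      (\<Sum>x\<in>Poly_Mapping.keys p. Poly_Mapping.single x (Poly_Mapping.lookup p x)) y =
      Poly_Mapping.lookup p y"
    by (simp add: lookup_sum lookup_single when_def in_keys_iff)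
qed

lemma poly_mapping_additive_induct:
  assumes "\<And>x c. Q (Poly_Mapping.single x c)" "\<And>p q. Q p \<Longrightarrow> Q q \<Longrightarrow> Q (p + q)" "Q 0"
  shows "Q (p :: 'x \<Rightarrow>\<^sub>0 'c::comm_monoid_add)"
proof -
  have "Q (\<Sum>x\<in>A. Poly_Mapping.single x (Poly_Mapping.lookup p x))" if "finite A" for A
    using that by (induction A) (simp_all add: assms)
  then show ?thesis by (metis finite_keys sum_monomials)
qed

lemma lattice_act_mult:
  assumes "additive g"
  shows "lattice_act g (p * q) = lattice_act g p * lattice_act g q"
proof (induction p rule: poly_mapping_additive_induct)
  case (1 x c)
  show ?case
    by (induction q rule: poly_mapping_additive_induct)
      (simp_all add: mult_single lattice_act_single lattice_act_add distrib_left
        additive.add[OF assms], simp add: lattice_act_def)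
qed (simp_all add: lattice_act_add distrib_right, simp add: lattice_act_def)

lemma lattice_deriv_mult:
  assumes "additive \<xi>"
  shows "lattice_deriv \<xi> (p * q) = lattice_deriv \<xi> p * q + p * lattice_deriv \<xi> q"
proof (induction p rule: poly_mapping_additive_induct)
  case (1 x c)
  show ?case
    by (induction q rule: poly_mapping_additive_induct)
      (simp_all add: mult_single lattice_deriv_single lattice_deriv_add algebra_simps
        additive.add[OF assms] flip: single_add, simp add: lattice_deriv_def)
qed (simp_all add: lattice_deriv_add algebra_simps, simp add: lattice_deriv_def)

lemma bij_lattice_act:
  assumes "bij g"
  shows "bij (lattice_act g)"
proof -
  have comp: "lattice_act f (lattice_act h p) = lattice_act (f \<circ> h) p"
    for f h :: "'a \<Rightarrow> 'a" and p :: "'a \<Rightarrow>\<^sub>0 'b"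
    by (induction p rule: poly_mapping_additive_induct)
      (simp_all add: lattice_act_single lattice_act_add, simp add: lattice_act_def)
  have id: "lattice_act id p = p" for p :: "'a \<Rightarrow>\<^sub>0 'b"
    by (simp add: lattice_act_def sum_monomials)
  have inv: "inv g \<circ> g = id" "g \<circ> inv g = id"
    using assms by (simp_all add: bij_is_inj bij_is_surj flip: surj_iff)
  show ?thesis
    by (rule o_bij[of "lattice_act (inv g)"]; rule ext; simp only: o_apply[of "lattice_act _"] comp inv id id_apply)
qed

abbreviation ring_act ::
    "('x \<Rightarrow> 'x) \<Rightarrow> ('x::ab_group_add \<Rightarrow>\<^sub>0 'k::field_char_0) tfrac \<Rightarrow> ('x \<Rightarrow>\<^sub>0 'k) tfrac" where
  "ring_act g \<equiv> tfrac_aut (lattice_act g)"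

abbreviation partial_deriv ::
    "('x \<Rightarrow> 'k) \<Rightarrow> ('x::ab_group_add \<Rightarrow>\<^sub>0 'k::field_char_0) tfrac \<Rightarrow> ('x \<Rightarrow>\<^sub>0 'k) tfrac" where
  "partial_deriv \<xi> \<equiv> tfrac_deriv (lattice_deriv \<xi>)"

lemma ring_act_Frac:
  "additive g \<Longrightarrow> bij g \<Longrightarrow> non_zero_divisor s \<Longrightarrow>
     ring_act g (Frac p s) = Frac (lattice_act g p) (lattice_act g s)"
  by (intro tfrac_aut_Frac bij_lattice_act lattice_act_mult lattice_act_add)

lemma partial_deriv_Frac:
  "additive \<xi> \<Longrightarrow> non_zero_divisor s \<Longrightarrow>
     partial_deriv \<xi> (Frac p s) = Frac (lattice_deriv \<xi> p * s - p * lattice_deriv \<xi> s) (s * s)"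
  by (intro tfrac_deriv_Frac lattice_deriv_mult lattice_deriv_add)

definition mult_op ::
    "('x::ab_group_add \<Rightarrow>\<^sub>0 int) \<Rightarrow>
     (('x \<Rightarrow> 'x) \<Rightarrow> ('x \<Rightarrow>\<^sub>0 'k::field_char_0) tfrac) \<Rightarrow> ('x \<Rightarrow> 'x) \<Rightarrow> ('x \<Rightarrow>\<^sub>0 'k) tfrac" where
  "mult_op p f = (\<lambda>w. incl p * f w)"

text \<open>\<open>g \<cdot> (f \<otimes> w) = g(f) \<otimes> g w\<close>\<close>

definition weyl_op ::
    "('x \<Rightarrow> 'x) \<Rightarrow>
     (('x \<Rightarrow> 'x) \<Rightarrow> ('x::ab_group_add \<Rightarrow>\<^sub>0 'k::field_char_0) tfrac) \<Rightarrow> ('x \<Rightarrow> 'x) \<Rightarrow> ('x \<Rightarrow>\<^sub>0 'k) tfrac" where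
  "weyl_op g f = (\<lambda>w. ring_act g (f (inv g \<circ> w)))"

definition dunkl_op ::
    "'x::ab_group_add set \<Rightarrow> ('x \<Rightarrow> 'x \<Rightarrow> int) \<Rightarrow> 'x set \<Rightarrow> ('x \<Rightarrow> nat) \<Rightarrow> ('x \<Rightarrow> 'k) \<Rightarrow>
     (('x \<Rightarrow> 'x) \<Rightarrow> ('x \<Rightarrow>\<^sub>0 'k::field_char_0) tfrac) \<Rightarrow> ('x \<Rightarrow> 'x) \<Rightarrow> ('x \<Rightarrow>\<^sub>0 'k) tfrac" where
  "dunkl_op R cor P k \<xi> f =
     (\<lambda>w. if w \<in> weyl_group R cor then
        partial_deriv \<xi> (f w) +
        scalar (1/2) * (\<Sum>\<alpha>\<in>P. scalar (of_nat (k \<alpha>) * \<xi> (bar \<alpha>)) *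
          Frac (1 + gexp (bar \<alpha>)) (1 - gexp (bar \<alpha>)) *
          (f w - ring_act (reflection cor \<alpha>) (f (reflection cor \<alpha> \<circ> w))))
      else 0)"


section \<open>The trigonometric Cherednik algebra\<close>

text \<open>Endomorphisms of \<open>M\<close> are functions that are \<open>undefined\<close> outside \<open>M\<close>; their product is
  \<^term>\<open>compose M\<close>.\<close>

inductive_set end_subalgebra ::
    "('k \<Rightarrow> 'm \<Rightarrow> 'm::ab_group_add) \<Rightarrow> 'm set \<Rightarrow> ('m \<Rightarrow> 'm) set \<Rightarrow> ('m \<Rightarrow> 'm) set"
  for s :: "'k \<Rightarrow> 'm \<Rightarrow> 'm::ab_group_add" and M :: "'m set" and G :: "('m \<Rightarrow> 'm) set" where
  "a \<in> G \<Longrightarrow> a \<in> end_subalgebra s M G"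
| "(\<lambda>u\<in>M. u) \<in> end_subalgebra s M G"
| "a \<in> end_subalgebra s M G \<Longrightarrow> b \<in> end_subalgebra s M G \<Longrightarrow>
     (\<lambda>u\<in>M. a u + b u) \<in> end_subalgebra s M G"
| "a \<in> end_subalgebra s M G \<Longrightarrow> (\<lambda>u\<in>M. s c (a u)) \<in> end_subalgebra s M G"
| "a \<in> end_subalgebra s M G \<Longrightarrow> b \<in> end_subalgebra s M G \<Longrightarrow>
     compose M a b \<in> end_subalgebra s M G"

definition cherednik_algebra ::
    "'x::ab_group_add set \<Rightarrow> ('x \<Rightarrow> 'x \<Rightarrow> int) \<Rightarrow> 'x set \<Rightarrow> ('x \<Rightarrow> nat) \<Rightarrow>
     ((('x \<Rightarrow> 'x) \<Rightarrow> ('x \<Rightarrow>\<^sub>0 'k::field_char_0) tfrac) \<Rightarrow> ('x \<Rightarrow> 'x) \<Rightarrow> ('x \<Rightarrow>\<^sub>0 'k) tfrac) set" where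
  "cherednik_algebra R cor P k =
     end_subalgebra kscale (regular_module R cor P)
       ({restrict (mult_op p) (regular_module R cor P) | p. True} \<union>
        {restrict (weyl_op g) (regular_module R cor P) | g. g \<in> weyl_group R cor} \<union>
        {restrict (dunkl_op R cor P k \<xi>) (regular_module R cor P) | \<xi>. additive \<xi>})"

text \<open>\<open>N\<close> with \<open>act\<close> is a left module over the algebra \<open>H\<close> of endomorphisms of \<open>M\<close>.\<close>

definition left_module ::
    "('k::comm_ring_1 \<Rightarrow> 'm \<Rightarrow> 'm::ab_group_add) \<Rightarrow> 'm set \<Rightarrow> ('m \<Rightarrow> 'm) set \<Rightarrow> 'm set \<Rightarrow>
     (('m \<Rightarrow> 'm) \<Rightarrow> 'm \<Rightarrow> 'm) \<Rightarrow> bool" where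
  "left_module s M H N act \<longleftrightarrow>
     module.subspace s N \<and>
     (\<forall>a\<in>H. \<forall>u\<in>N. act a u \<in> N) \<and>
     (\<forall>a\<in>H. \<forall>u\<in>N. \<forall>v\<in>N. act a (u + v) = act a u + act a v) \<and>
     (\<forall>a\<in>H. \<forall>b\<in>H. \<forall>u\<in>N. act (\<lambda>v\<in>M. a v + b v) u = act a u + act b u) \<and>
     (\<forall>a\<in>H. \<forall>b\<in>H. \<forall>u\<in>N. act (compose M a b) u = act a (act b u)) \<and>
     (\<forall>u\<in>N. act (\<lambda>v\<in>M. v) u = u) \<and>
     (\<forall>a\<in>H. \<forall>c. \<forall>u\<in>N. act (\<lambda>v\<in>M. s c (a v)) u = s c (act a u) \<and> act a (s c u) = s c (act a u))"

end

theory Submission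
  imports Defs
begin

text \<open>Since \<open>T\<^sub>\<xi>\<close> is \<open>k\<close>-linear in \<open>\<xi>\<close> and the lattice is free, it suffices to treat integral
  \<open>\<xi>\<close>, and for those \<open>2T\<^sub>\<xi>\<close> already preserves the quasi-invariants over \<open>\<int>\<close>.  Fix a positive root
  \<open>\<beta>\<close>, put \<open>t = 1 - e\<^sup>b\<close> with \<open>b\<close> the bar of \<open>\<beta>\<close>, and compare the components at \<open>s\<^sub>\<beta>w\<close> and \<open>w\<close>
  modulo \<open>t\<^sup>m\<close>, \<open>m = 2k\<^sub>\<beta>\<close>.  For \<open>\<alpha> \<noteq> \<beta>\<close> the identity \<open>s\<^sub>\<alpha>s\<^sub>\<beta> = s\<^sub>\<gamma>s\<^sub>\<alpha>\<close> with \<open>\<gamma> = s\<^sub>\<alpha>\<beta>\<close> shows that the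
  numerator of the \<open>\<alpha>\<close>-summand changes by a multiple of \<open>t\<^sup>m\<close>, and its denominator is a
  non-zero-divisor modulo \<open>t\<close> because \<open>\<alpha>\<close> and \<open>\<beta>\<close> are not proportional.  The \<open>\<beta>\<close>-summand and
  \<open>2\<partial>\<^sub>\<xi>\<close> each lose one power of \<open>t\<close>, and these two contributions cancel.\<close>

section \<open>Group rings\<close>

lemma zscale_0 [simp]: "zscale 0 x = 0"
  by (rule module.scale_zero_left[OF module_zscale])

lemma zscale_1 [simp]: "zscale 1 x = x"
  by (rule module.scale_one[OF module_zscale])

lemma zscale_add: "zscale (m + n) x = zscale m x + zscale n x"
  by (rule module.scale_left_distrib[OF module_zscale])

lemma zscale_minus: "zscale (- n) x = - zscale n x"
  by (rule module.scale_minus_left[OF module_zscale])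

lemma zscale_diff_left: "zscale (m - n) x = zscale m x - zscale n x"
  by (rule module.scale_left_diff_distrib[OF module_zscale])

lemma zscale_add_right: "zscale n (x + y) = zscale n x + zscale n y"
  by (rule module.scale_right_distrib[OF module_zscale])

lemma zscale_minus_right: "zscale n (- x) = - zscale n x"
  by (rule module.scale_minus_right[OF module_zscale])

lemma zscale_diff_right: "zscale n (x - y) = zscale n x - zscale n y"
  by (rule module.scale_right_diff_distrib[OF module_zscale])

lemma zscale_zscale: "zscale m (zscale n x) = zscale (m * n) x"
  by (rule module.scale_scale[OF module_zscale])

lemma additive_zscale:
  assumes "additive g"
  shows "g (zscale n x) = zscale n (g x)"
  by (simp add: zscale_def additive.diff[OF assms] additive.sum[OF assms])

lemma additive_zscale_int:
  fixes g :: "'x::ab_group_add \<Rightarrow> 'r::ring_1"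
  assumes "additive g"
  shows "g (zscale n x) = of_int n * g x"
proof (cases n rule: int_cases2)
  case (nonneg m)
  then show ?thesis by (simp add: zscale_def additive.sum[OF assms])
next
  case (nonpos m)
  then show ?thesis by (simp add: zscale_def additive.minus[OF assms] additive.sum[OF assms])
qed

lemma gexp_mult: "(gexp x :: 'x::ab_group_add \<Rightarrow>\<^sub>0 'c::comm_ring_1) * gexp y = gexp (x + y)"
  by (simp add: mult_single)

lemma lookup_gexp_mult:
  "Poly_Mapping.lookup ((gexp y :: 'x::ab_group_add \<Rightarrow>\<^sub>0 'c::comm_ring_1) * a) x = Poly_Mapping.lookup a (x - y)"
  by (induction a rule: poly_mapping_additive_induct)
    (simp_all add: mult_single lookup_single lookup_add distrib_left when_def algebra_simps)

text \<open>An element annihilated by \<open>1 - gexp b\<close> has coefficients invariant under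
  translation by \<open>b\<close>. As \<open>b\<close> has infinite order, one nonzero coefficient
  would recur infinitely often, against finite support. The coefficient ring is general because both
  the integers and the field occur later.\<close>

lemma non_zero_divisor_1_minus_gexp:
  fixes b :: "'x::ab_group_add"
  assumes "\<And>n. n \<noteq> 0 \<Longrightarrow> zscale n b \<noteq> 0"
  shows "non_zero_divisor (1 - gexp b :: 'x \<Rightarrow>\<^sub>0 'c::comm_ring_1)"
  unfolding non_zero_divisor_def
proof (intro allI impI)
  fix a :: "'x \<Rightarrow>\<^sub>0 'c" assume "a * (1 - gexp b) = 0"
  then have eq: "a = gexp b * a" by (simp add: algebra_simps)
  have shift: "Poly_Mapping.lookup a (x - zscale (int n) b) = Poly_Mapping.lookup a x" for n x
  proof (induction n)
    case (Suc n)
    have "Poly_Mapping.lookup a (x - zscale (int (Suc n)) b) =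
        Poly_Mapping.lookup (gexp b * a) (x - zscale (int n) b)"
      by (simp only: lookup_gexp_mult) (simp add: zscale_add algebra_simps)
    then show ?case using Suc eq by simp
  qed simp
  have "Poly_Mapping.lookup a x = 0" for x
  proof (rule ccontr)
    assume "Poly_Mapping.lookup a x \<noteq> 0"
    then have "range (\<lambda>n. x - zscale (int n) b) \<subseteq> Poly_Mapping.keys a"
      using shift by (auto simp: in_keys_iff)
    moreover have "inj (\<lambda>n. x - zscale (int n) b)"
    proof (rule injI)
      fix m n assume "x - zscale (int m) b = x - zscale (int n) b"
      then have "zscale (int m - int n) b = 0" by (simp add: zscale_diff_left)
      then have "int m - int n = 0" using assms by blast
      then show "m = n" by simp
    qed
    ultimately show False
      using finite_imageD[of "\<lambda>n. x - zscale (int n) b" UNIV] finite_subset[OF _ finite_keys[of a]] by simp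
  qed
  then show "a = 0" by (intro poly_mapping_eqI) simp
qed

text \<open>Each step by \<open>b\<close> changes a monomial by a monomial multiple of
  \<open>1 - gexp b\<close>, so the difference telescopes.\<close>

lemma one_minus_gexp_dvd:
  "(1 - gexp b :: 'x::ab_group_add \<Rightarrow>\<^sub>0 'c::comm_ring_1) dvd gexp (x + zscale n b) - gexp x"
proof -
  have nat: "(1 - gexp b :: 'x \<Rightarrow>\<^sub>0 'c) dvd gexp (x + zscale (int n) b) - gexp x" for n x
  proof (induction n)
    case (Suc n)
    have "(gexp (x + zscale (int (Suc n)) b) - gexp x :: 'x \<Rightarrow>\<^sub>0 'c) =
        (gexp (x + zscale (int n) b) - gexp x) - gexp (x + zscale (int n) b) * (1 - gexp b)"
      by (simp add: algebra_simps gexp_mult zscale_add)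
    then show ?case using Suc by (metis dvd_diff dvd_triv_right)
  qed simp
  show ?thesis
  proof (cases n rule: int_cases2)
    case (nonneg m)
    then show ?thesis using nat by simp
  next
    case (nonpos m)
    \<comment> \<open>For a negative multiple, climb \<open>m\<close> steps from the lower monomial
      back to \<open>gexp x\<close> and reverse the sign.\<close>
    have "(1 - gexp b :: 'x \<Rightarrow>\<^sub>0 'c) dvd - (gexp (x + zscale n b + zscale (int m) b) - gexp (x + zscale n b))"
      using nat by (simp only: dvd_minus_iff)
    then show ?thesis by (simp add: nonpos zscale_minus)
  qed
qed

lemma frag_extend_single: "frag_extend f (Poly_Mapping.single x c) = frag_cmul c (f x)"
  by (simp add: frag_extend_def)

text \<open>The integral group ring is free abelian on the monomials and \<open>frag_extend\<close>
  extends additively from them, so a congruence between two extensions can be checked on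
  monomials.\<close>

lemma frag_extend_diff_dvd:
  fixes f h :: "'y \<Rightarrow> 'x::ab_group_add \<Rightarrow>\<^sub>0 int"
  assumes "\<And>x. d dvd f x - h x"
  shows "d dvd frag_extend f p - frag_extend h p"
proof (rule frag_induction[where S = UNIV and P = "\<lambda>p. d dvd frag_extend f p - frag_extend h p"])
  fix a b
  assume "d dvd frag_extend f a - frag_extend h a" "d dvd frag_extend f b - frag_extend h b"
  then have "d dvd (frag_extend f a - frag_extend h a) - (frag_extend f b - frag_extend h b)"
    by (rule dvd_diff)
  then show "d dvd frag_extend f (a - b) - frag_extend h (a - b)"
    by (simp add: frag_extend_diff algebra_simps)
qed (use assms in auto)

text \<open>A Laurent polynomial is divisible by \<open>1 - e\<^sup>b\<close> iff its coefficients sum to zero over each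
  coset of \<open>\<int>b\<close>, that is, iff \<open>coset_sums b p = 0\<close>.\<close>

definition coset_rep :: "'x::ab_group_add \<Rightarrow> 'x \<Rightarrow> 'x" where
  "coset_rep b x = (SOME y. \<exists>n. y = x + zscale n b)"

definition coset_sums :: "'x::ab_group_add \<Rightarrow> ('x \<Rightarrow>\<^sub>0 int) \<Rightarrow> 'x \<Rightarrow>\<^sub>0 int" where
  "coset_sums b = frag_extend (\<lambda>x. frag_of (coset_rep b x))"

lemma coset_rep: "\<exists>n. coset_rep b x = x + zscale n b"
  unfolding coset_rep_def by (rule someI_ex) blast

text \<open>The predicate behind the choice depends only on the coset, so equal cosets select the
  same point.\<close>

lemma coset_rep_shift: "coset_rep b (x + zscale m b) = coset_rep b x"
proof -
  have "(\<exists>n. y = x + zscale m b + zscale n b) \<longleftrightarrow> (\<exists>n. y = x + zscale n b)" for y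
  proof
    assume "\<exists>n. y = x + zscale n b"
    then obtain n where "y = x + zscale n b" ..
    then have "y = x + zscale m b + zscale (n - m) b" by (simp add: zscale_diff_left)
    then show "\<exists>n. y = x + zscale m b + zscale n b" ..
  qed (auto simp: add.assoc simp flip: zscale_add)
  then show ?thesis by (simp add: coset_rep_def)
qed

text \<open>Each monomial moves to the representative inside its own coset, which costs a multiple
  of \<open>1 - gexp b\<close>.\<close>

lemma coset_sums_dvd: "(1 - gexp b) dvd coset_sums b p - p"
proof -
  have "(1 - gexp b) dvd coset_sums b p - frag_extend frag_of p"
    unfolding coset_sums_def
    by (rule frag_extend_diff_dvd) (metis coset_rep one_minus_gexp_dvd)
  then show ?thesis by (simp flip: frag_expansion)
qed

lemma coset_sums_diff: "coset_sums b (p - q) = coset_sums b p - coset_sums b q"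
  by (simp add: coset_sums_def frag_extend_diff)

lemma coset_sums_mult_eq_0: "coset_sums b ((1 - gexp b) * p) = 0"
proof (induction p rule: poly_mapping_additive_induct)
  case (1 x c)
  have "coset_rep b (b + x) = coset_rep b x"
    using coset_rep_shift[of b x 1] by (simp add: add.commute)
  then show ?case
    by (simp add: left_diff_distrib mult_single coset_sums_def frag_extend_diff frag_extend_single)
qed (simp_all add: distrib_left coset_sums_def frag_extend_add)

lemma dvd_iff_coset_sums: "(1 - gexp b) dvd p \<longleftrightarrow> coset_sums b p = 0"
proof
  assume "(1 - gexp b) dvd p"
  then show "coset_sums b p = 0" by (metis coset_sums_mult_eq_0 dvdE)
next
  assume "coset_sums b p = 0"
  then show "(1 - gexp b) dvd p" using coset_sums_dvd[of b p] by simp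
qed

text \<open>However \<open>p\<close> is translated, the support is indexed by the same finite set
  \<open>keys p\<close>; the pigeonhole argument for coprimality draws on this.\<close>

lemma keys_coset_sums_gexp_mult:
  "Poly_Mapping.keys (coset_sums b (gexp x * p)) \<subseteq> (\<lambda>v. coset_rep b (x + v)) ` Poly_Mapping.keys p"
proof -
  have "Poly_Mapping.keys (coset_sums b (gexp x * p)) \<subseteq> coset_rep b ` Poly_Mapping.keys (gexp x * p)"
    using keys_frag_extend[of "\<lambda>x. frag_of (coset_rep b x)" "gexp x * p"]
    by (auto simp: coset_sums_def)
  also have "\<dots> \<subseteq> (\<lambda>v. coset_rep b (x + v)) ` Poly_Mapping.keys p"
    using keys_mult[of "gexp x :: _ \<Rightarrow>\<^sub>0 int" p] by auto
  finally show ?thesis .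
qed

text \<open>By hypothesis \<open>p\<close> is, modulo \<open>1 - gexp b\<close>, invariant under
  multiplication by \<open>gexp (zscale (int n) a)\<close> for every \<open>n\<close>. Its coset
  sums have finite support, while the multiples of \<open>a\<close> lie in pairwise distinct cosets,
  so the sums must vanish.\<close>

lemma one_minus_gexp_coprime:
  fixes p :: "'x::ab_group_add \<Rightarrow>\<^sub>0 int"
  assumes indep: "\<And>n m. n \<noteq> 0 \<Longrightarrow> zscale n a \<noteq> zscale m b"
    and dvd: "(1 - gexp b) dvd (1 - gexp a) * p"
  shows "(1 - gexp b) dvd p"
proof -
  have shift: "coset_sums b (gexp (zscale (int n) a) * p) = coset_sums b p" for n
  proof -
    have "(1 - gexp a :: 'x \<Rightarrow>\<^sub>0 int) dvd gexp (0 + zscale (int n) a) - gexp 0"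
      by (rule one_minus_gexp_dvd)
    then have "(1 - gexp a) * p dvd (gexp (zscale (int n) a) - 1) * p"
      by (intro mult_dvd_mono) simp_all
    then have "(1 - gexp b) dvd (gexp (zscale (int n) a) - 1) * p"
      using dvd by (rule dvd_trans[rotated])
    then have "(1 - gexp b) dvd gexp (zscale (int n) a) * p - p"
      by (simp add: left_diff_distrib)
    then show ?thesis by (simp add: dvd_iff_coset_sums coset_sums_diff)
  qed
  have "Poly_Mapping.keys (coset_sums b p) = {}"
  proof (rule equals0I)
    fix x assume "x \<in> Poly_Mapping.keys (coset_sums b p)"
    then have "\<exists>v\<in>Poly_Mapping.keys p. x = coset_rep b (zscale (int n) a + v)" for n
      using keys_coset_sums_gexp_mult[of b "zscale (int n) a" p] by (auto simp: shift)
    \<comment> \<open>\<open>v n\<close> is a support point of \<open>p\<close> whose translate by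
      \<open>zscale (int n) a\<close> falls into the coset represented by \<open>x\<close>.\<close>
    then obtain v where v: "\<And>n. v n \<in> Poly_Mapping.keys p" "\<And>n. x = coset_rep b (zscale (int n) a + v n)"
      by metis
    \<comment> \<open>Pigeonhole: two indices share a support point, which makes a nonzero multiple
      of \<open>a\<close> a multiple of \<open>b\<close>.\<close>
    have "\<not> inj v"
      using v(1) finite_imageD[of v UNIV] finite_subset[OF _ finite_keys[of p], of "range v"] by auto
    then obtain m n where mn: "m \<noteq> n" "v m = v n" by (auto simp: inj_def)
    obtain i j where "x = zscale (int m) a + v m + zscale i b" "x = zscale (int n) a + v n + zscale j b"
      using coset_rep v(2) by metis
    then have "zscale (int m - int n) a = zscale (j - i) b"
      using mn(2) by (simp add: zscale_diff_left algebra_simps)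
    then show False using indep mn(1) by simp
  qed
  then show ?thesis by (simp add: dvd_iff_coset_sums)
qed

lemma non_zero_divisor_mult_dvd_cancel:
  "non_zero_divisor s \<Longrightarrow> s * a dvd s * b \<longleftrightarrow> a dvd b"
proof
  assume s: "non_zero_divisor s"
  assume "s * a dvd s * b"
  then obtain c where "s * b = s * a * c" by (rule dvdE)
  then have "b * s = (a * c) * s" by (simp add: ac_simps)
  then have "b = a * c" using non_zero_divisor_cancel[OF s] by blast
  then show "a dvd b" by (rule dvdI)
qed (simp add: mult_dvd_mono)

text \<open>Induction on the exponent: coprimality extracts one factor \<open>1 - gexp b\<close>
  from \<open>p\<close>, and this factor cancels as a non-zero-divisor.\<close>

lemma one_minus_gexp_power_coprime:
  fixes p :: "'x::ab_group_add \<Rightarrow>\<^sub>0 int"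
  assumes indep: "\<And>n m. n \<noteq> 0 \<Longrightarrow> zscale n a \<noteq> zscale m b"
    and b: "\<And>n. n \<noteq> 0 \<Longrightarrow> zscale n b \<noteq> 0"
    and "(1 - gexp b) ^ m dvd (1 - gexp a) * p"
  shows "(1 - gexp b) ^ m dvd p"
  using assms(3)
proof (induction m arbitrary: p)
  case (Suc m)
  have "(1 - gexp b) dvd (1 - gexp a) * p" using Suc.prems by (metis dvd_mult_left power_Suc)
  then have "(1 - gexp b) dvd p" by (rule one_minus_gexp_coprime[rotated]) (rule indep)
  then obtain q where q: "p = (1 - gexp b) * q" by (rule dvdE)
  have nzd: "non_zero_divisor (1 - gexp b :: 'x \<Rightarrow>\<^sub>0 int)" by (rule non_zero_divisor_1_minus_gexp) (rule b)
  have "(1 - gexp b) * (1 - gexp b) ^ m dvd (1 - gexp b) * ((1 - gexp a) * q)"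
    using Suc.prems by (simp add: q ac_simps)
  then have "(1 - gexp b) ^ m dvd q"
    using Suc.IH by (simp only: non_zero_divisor_mult_dvd_cancel[OF nzd])
  then show ?case unfolding q power_Suc by (rule mult_dvd_mono[OF dvd_refl])
qed simp

text \<open>\<open>lattice_act\<close> and \<open>lattice_deriv\<close> are typed for field
  coefficients, whereas the congruences live over the integers. \<open>frag_act\<close> and
  \<open>frag_deriv\<close> are the integral counterparts, the latter for integer-valued
  functionals.\<close>

definition frag_act :: "('x \<Rightarrow> 'x) \<Rightarrow> ('x::ab_group_add \<Rightarrow>\<^sub>0 int) \<Rightarrow> 'x \<Rightarrow>\<^sub>0 int" where
  "frag_act g = frag_extend (\<lambda>x. frag_of (g x))"

definition frag_deriv :: "('x \<Rightarrow> int) \<Rightarrow> ('x::ab_group_add \<Rightarrow>\<^sub>0 int) \<Rightarrow> 'x \<Rightarrow>\<^sub>0 int" where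
  "frag_deriv \<eta> = frag_extend (\<lambda>x. Poly_Mapping.single x (\<eta> x))"

lemma frag_cmul_single: "frag_cmul c (Poly_Mapping.single x a) = Poly_Mapping.single x (c * a)"
  by (rule poly_mapping_eqI) (simp add: lookup_single when_def)

lemma frag_act_single: "frag_act g (Poly_Mapping.single x c) = Poly_Mapping.single (g x) c"
  by (simp add: frag_act_def frag_extend_single frag_cmul_single)

lemma frag_deriv_single:
  "frag_deriv \<eta> (Poly_Mapping.single x c) = Poly_Mapping.single x (\<eta> x * c)"
  by (simp add: frag_deriv_def frag_extend_single frag_cmul_single mult.commute)

lemma frag_act_0 [simp]: "frag_act g 0 = 0"
  and frag_act_add: "frag_act g (p + q) = frag_act g p + frag_act g q"
  and frag_act_diff: "frag_act g (p - q) = frag_act g p - frag_act g q"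
  by (simp_all add: frag_act_def frag_extend_add frag_extend_diff)

lemma frag_deriv_0 [simp]: "frag_deriv \<eta> 0 = 0"
  and frag_deriv_add: "frag_deriv \<eta> (p + q) = frag_deriv \<eta> p + frag_deriv \<eta> q"
  and frag_deriv_diff: "frag_deriv \<eta> (p - q) = frag_deriv \<eta> p - frag_deriv \<eta> q"
  by (simp_all add: frag_deriv_def frag_extend_add frag_extend_diff)

lemma frag_act_mult:
  assumes "additive g"
  shows "frag_act g (p * q) = frag_act g p * frag_act g q"
proof (induction p rule: poly_mapping_additive_induct)
  case (1 x c)
  show ?case
    by (induction q rule: poly_mapping_additive_induct)
      (simp_all add: mult_single frag_act_single frag_act_add distrib_left additive.add[OF assms])
qed (simp_all add: frag_act_add distrib_right)

lemma frag_act_1: "additive g \<Longrightarrow> frag_act g 1 = 1"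
  using frag_act_single[of g 0 1] by (simp add: additive.zero)

lemma frag_act_power: "additive g \<Longrightarrow> frag_act g (p ^ n) = frag_act g p ^ n"
  by (induction n) (simp_all add: frag_act_1 frag_act_mult)

lemma frag_act_dvd: "additive g \<Longrightarrow> p dvd q \<Longrightarrow> frag_act g p dvd frag_act g q"
  by (auto simp: dvd_def frag_act_mult)

lemma frag_deriv_mult:
  assumes "additive \<eta>"
  shows "frag_deriv \<eta> (p * q) = frag_deriv \<eta> p * q + p * frag_deriv \<eta> q"
proof (induction p rule: poly_mapping_additive_induct)
  case (1 x c)
  show ?case
    by (induction q rule: poly_mapping_additive_induct)
      (simp_all add: mult_single frag_deriv_single frag_deriv_add algebra_simps
        additive.add[OF assms] flip: single_add)
qed (simp_all add: frag_deriv_add algebra_simps)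

lemma frag_deriv_1: "additive \<eta> \<Longrightarrow> frag_deriv \<eta> 1 = 0"
  using frag_deriv_single[of \<eta> 0 1] by (simp add: additive.zero)

lemma frag_deriv_power:
  "additive \<eta> \<Longrightarrow> frag_deriv \<eta> (p ^ Suc n) = of_nat (Suc n) * p ^ n * frag_deriv \<eta> p"
  by (induction n) (simp_all add: frag_deriv_mult frag_deriv_1 algebra_simps)

section \<open>Root data\<close>

context root_datum
begin

abbreviation refl :: "'x \<Rightarrow> 'x \<Rightarrow> 'x" where "refl \<equiv> reflection cor"
abbreviation W :: "('x \<Rightarrow> 'x) set" where "W \<equiv> weyl_group R cor"

text \<open>In coordinates for a lattice basis, independence forces \<open>n\<close> times each
  coordinate of \<open>x\<close> to vanish.\<close>

lemma torsion_free:
  assumes "zscale n x = 0"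
  shows "n = 0 \<or> (x::'x) = 0"
proof -
  interpret X: module "zscale :: int \<Rightarrow> 'x \<Rightarrow> 'x" by (rule module_zscale)
  obtain B :: "'x set" where B: "finite B" "\<not> X.dependent B" "X.span B = UNIV" using lattice by blast
  have x: "(\<Sum>v\<in>B. zscale (X.representation B x v) v) = x"
    using X.sum_representation_eq[of B x B] B by simp
  have "(\<Sum>v\<in>B. zscale (n * X.representation B x v) v) =
      zscale n (\<Sum>v\<in>B. zscale (X.representation B x v) v)"
    by (simp add: X.scale_sum_right)
  also have "\<dots> = 0" using assms x by simp
  finally have zero: "n * X.representation B x v = 0" if "v \<in> B" for v
    using B X.independentD[of B B "\<lambda>v. n * X.representation B x v" v] that by blast
  show ?thesis
  proof (cases "n = 0")
    case False
    then have "zscale (X.representation B x v) v = 0" if "v \<in> B" for v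
      using zero[OF that] by simp
    then show ?thesis using x by simp
  qed simp
qed

text \<open>Halves are unique by torsion-freeness, as the definite description in \<open>bar\<close>
  requires.\<close>

lemma double_cancel: "(x::'x) + x = y + y \<Longrightarrow> x = y"
proof -
  assume "x + x = y + y"
  then have "zscale 2 (x - y) = 0"
    using zscale_add[of 1 1 "x - y"] by (simp add: algebra_simps)
  then show "x = y" using torsion_free[of 2 "x - y"] by simp
qed

lemma bar_double: "x + x = y \<Longrightarrow> bar y = (x::'x)"
proof -
  assume x: "x + x = y"
  then have "(THE \<mu>. \<mu> + \<mu> = y) = x" by (intro the_equality) (auto intro: double_cancel)
  then show "bar y = x" using x by (auto simp: bar_def)
qed

lemma bar_cases: "bar x = x \<or> bar x + bar x = (x::'x)"
proof (cases "\<exists>y. y + y = x")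
  case True
  then show ?thesis using bar_double by auto
qed (simp add: bar_def)

text \<open>A lattice automorphism preserves and reflects divisibility by two; bijectivity pulls a
  half of \<open>g x\<close> back to a half of \<open>x\<close>.\<close>

lemma bar_image:
  fixes x :: 'x and g :: "'x \<Rightarrow> 'x"
  assumes "additive g" "bij g"
  shows "bar (g x) = g (bar x)"
proof (cases "\<exists>y. y + y = x")
  case True
  then obtain y where y: "y + y = x" ..
  then have "g y + g y = g x" using additive.add[OF assms(1), of y y] by simp
  then show ?thesis using bar_double y by metis
next
  case False
  have "\<nexists>y. y + y = g x"
  proof
    assume "\<exists>y. y + y = g x"
    then obtain z where "g z + g z = g x" using assms(2) by (metis bij_pointE)
    then have "g (z + z) = g x" by (simp add: additive.add[OF assms(1)])
    then have "z + z = x" using assms(2) by (simp add: bij_is_inj inj_eq)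
    then show False using False by blast
  qed
  then show ?thesis using False by (simp add: bar_def)
qed

lemma bar_uminus: "bar (- x) = - bar (x::'x)"
proof (rule bar_image)
  show "additive (uminus :: 'x \<Rightarrow> 'x)" by (simp add: additive_def)
  show "bij (uminus :: 'x \<Rightarrow> 'x)" by (rule o_bij[of uminus]) auto
qed

lemma root_nonzero: "\<alpha> \<in> R \<Longrightarrow> \<alpha> \<noteq> 0"
  using cor_self additive.zero[OF additive_cor] by force

lemma bar_nonzero: "\<alpha> \<in> R \<Longrightarrow> bar \<alpha> \<noteq> 0"
  using bar_cases[of \<alpha>] root_nonzero by fastforce

lemma zscale_bar_nonzero: "\<alpha> \<in> R \<Longrightarrow> n \<noteq> 0 \<Longrightarrow> zscale n (bar \<alpha>) \<noteq> 0"
  using torsion_free bar_nonzero by blast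

section \<open>Reflections and the Weyl group\<close>

lemma additive_reflection: "\<alpha> \<in> R \<Longrightarrow> additive (refl \<alpha>)"
  by (rule additive.intro) (simp add: reflection_def additive.add[OF additive_cor] zscale_add)

lemma reflection_self: "\<alpha> \<in> R \<Longrightarrow> refl \<alpha> \<alpha> = - \<alpha>"
  using zscale_add[of 1 1 \<alpha>] by (simp add: reflection_def cor_self)

lemma reflection_reflection [simp]: "\<alpha> \<in> R \<Longrightarrow> refl \<alpha> (refl \<alpha> x) = x"
  by (simp add: reflection_def additive.diff[OF additive_cor] additive_zscale_int[OF additive_cor]
      cor_self zscale_diff_left)
    (simp add: zscale_minus mult_2_right zscale_add)

lemma bij_reflection: "\<alpha> \<in> R \<Longrightarrow> bij (refl \<alpha>)"
  by (rule o_bij[of "refl \<alpha>"]) auto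

lemma uminus_root: "\<alpha> \<in> R \<Longrightarrow> - \<alpha> \<in> R"
  using reflection_root reflection_self by metis

text \<open>Stability of the coroots, applied to \<alpha> and its own reflection, which sends
  \<alpha> to its negative.\<close>

lemma cor_uminus: "\<alpha> \<in> R \<Longrightarrow> cor (- \<alpha>) x = - cor \<alpha> x"
  using cor_reflection[of \<alpha> \<alpha> x]
  by (simp add: reflection_self)
    (simp add: reflection_def additive.diff[OF additive_cor] additive_zscale_int[OF additive_cor] cor_self)

lemma reflection_uminus: "\<alpha> \<in> R \<Longrightarrow> refl (- \<alpha>) = refl \<alpha>"
  by (rule ext) (simp add: reflection_def cor_uminus zscale_minus zscale_minus_right)

lemma reflection_bar: "\<alpha> \<in> R \<Longrightarrow> refl \<alpha> (bar \<alpha>) = - bar \<alpha>"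
  using bar_image[OF additive_reflection bij_reflection] by (metis bar_uminus reflection_self)

lemma weyl_additive: "w \<in> W \<Longrightarrow> additive w"
  by (induction rule: weyl_group.induct) (auto simp: additive_def additive.add[OF additive_reflection])

lemma weyl_bij: "w \<in> W \<Longrightarrow> bij w"
  by (induction rule: weyl_group.induct) (blast intro: bij_id bij_comp bij_reflection)+

lemma weyl_root: "w \<in> W \<Longrightarrow> \<beta> \<in> R \<Longrightarrow> w \<beta> \<in> R"
  by (induction rule: weyl_group.induct) (auto intro: reflection_root)

lemma cor_weyl: "w \<in> W \<Longrightarrow> \<beta> \<in> R \<Longrightarrow> cor (w \<beta>) (w x) = cor \<beta> x"
  by (induction rule: weyl_group.induct) (auto simp: cor_reflection weyl_root)

text \<open>The conjugation rule that rewrites a component indexed by one reflection as one indexed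
  by the conjugate reflection; the Weyl and Dunkl stability proofs both turn on it.\<close>

lemma reflection_weyl: "w \<in> W \<Longrightarrow> \<beta> \<in> R \<Longrightarrow> refl (w \<beta>) \<circ> w = w \<circ> refl \<beta>"
  by (rule ext)
    (simp add: reflection_def cor_weyl additive.diff[OF weyl_additive] additive_zscale[OF weyl_additive])

lemma reflection_weyl_group: "\<alpha> \<in> R \<Longrightarrow> refl \<alpha> \<in> W"
  using weyl_reflection[OF _ weyl_id] by fastforce

lemma weyl_comp: "v \<in> W \<Longrightarrow> w \<in> W \<Longrightarrow> v \<circ> w \<in> W"
  by (induction rule: weyl_group.induct) (auto simp: comp_assoc intro: weyl_reflection)

lemma weyl_inv: "w \<in> W \<Longrightarrow> inv w \<in> W"
proof (induction rule: weyl_group.induct)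
  case (weyl_reflection \<alpha> w)
  have "inv (refl \<alpha>) = refl \<alpha>"
    using weyl_reflection.hyps by (intro inv_unique_comp) auto
  then have "inv (refl \<alpha> \<circ> w) = inv w \<circ> refl \<alpha>"
    using weyl_reflection.hyps by (simp add: o_inv_distrib weyl_bij bij_reflection)
  then show ?case
    using weyl_reflection by (simp only: weyl_comp reflection_weyl_group)
qed (simp only: inv_id weyl_id)

lemma weyl_comp_iff: "v \<in> W \<Longrightarrow> v \<circ> w \<in> W \<longleftrightarrow> w \<in> W"
proof
  assume v: "v \<in> W" and "v \<circ> w \<in> W"
  then have "inv v \<circ> (v \<circ> w) \<in> W" using weyl_comp weyl_inv by blast
  then show "w \<in> W" using v by (simp add: weyl_bij bij_is_inj flip: comp_assoc)
qed (rule weyl_comp)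

section \<open>Positive roots and proportionality\<close>

lemma positive_roots_subset: "positive_roots R P \<Longrightarrow> \<alpha> \<in> P \<Longrightarrow> \<alpha> \<in> R"
  by (auto simp: positive_roots_def)

lemma finite_positive_roots: "positive_roots R P \<Longrightarrow> finite P"
  using finite_roots positive_roots_subset by (meson finite_subset subsetI)

lemma positive_or_negative: "positive_roots R P \<Longrightarrow> \<alpha> \<in> R \<Longrightarrow> \<alpha> \<in> P \<or> - \<alpha> \<in> P"
  by (auto simp: positive_roots_def additive.minus uminus_root)

lemma zscale_2: "zscale 2 (x::'x) = x + x"
  using zscale_add[of 1 1 x] by simp

text \<open>If \<open>n\<alpha> = m\<beta>\<close> then \<open>\<langle>\<alpha>, \<beta>\<^sup>\<or>\<rangle>\<langle>\<beta>, \<alpha>\<^sup>\<or>\<rangle> = 4\<close> with both factors positive; the products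
  \<open>1 \<cdot> 4\<close> and \<open>4 \<cdot> 1\<close> contradict reducedness.\<close>

lemma positive_roots_proportional:
  assumes P: "positive_roots R P" and \<alpha>: "\<alpha> \<in> P" and \<beta>: "\<beta> \<in> P"
    and eq: "zscale n \<alpha> = zscale m \<beta>" and n: "n \<noteq> 0"
  shows "\<alpha> = \<beta>"
proof -
  have R: "\<alpha> \<in> R" "\<beta> \<in> R" using P \<alpha> \<beta> positive_roots_subset by auto
  \<comment> \<open>\<open>l\<close> is positive on both roots, so \<open>n\<close> and
    \<open>m\<close> have the same sign; this rules out opposite roots.\<close>
  obtain l :: "'x \<Rightarrow> real" where l: "additive l" "l \<alpha> > 0" "l \<beta> > 0"
    using P \<alpha> \<beta> by (auto simp: positive_roots_def)
  have "of_int n * l \<alpha> = of_int m * l \<beta>"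
    using arg_cong[OF eq, of l] by (simp add: additive_zscale_int[OF l(1)])
  then have "0 < of_int n * l \<alpha> \<longleftrightarrow> 0 < of_int m * l \<beta>" "of_int m * l \<beta> \<noteq> 0"
    using l n by auto
  then have nm: "0 < n \<longleftrightarrow> 0 < m" "m \<noteq> 0"
    using l by (auto simp: zero_less_mult_iff)
  have 1: "n * cor \<beta> \<alpha> = 2 * m"
    using arg_cong[OF eq, of "cor \<beta>"] R by (simp add: additive_zscale_int[OF additive_cor] cor_self)
  have 2: "m * cor \<alpha> \<beta> = 2 * n"
    using arg_cong[OF eq, of "cor \<alpha>"] R by (simp add: additive_zscale_int[OF additive_cor] cor_self)
  have "n * (cor \<beta> \<alpha> * cor \<alpha> \<beta>) = 2 * (m * cor \<alpha> \<beta>)" using 1 by simp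
  also have "\<dots> = n * 4" using 2 by simp
  finally have 4: "cor \<beta> \<alpha> * cor \<alpha> \<beta> = 4" using n by simp
  have pos: "cor \<beta> \<alpha> > 0"
  proof (cases "0 < n")
    case True
    then have "0 < n * cor \<beta> \<alpha>" using 1 nm by simp
    then show ?thesis using True by (simp add: zero_less_mult_iff)
  next
    case False
    then have "n < 0" "n * cor \<beta> \<alpha> < 0" using n nm 1 by auto
    then show ?thesis by (simp add: mult_less_0_iff)
  qed
  have dvd: "cor \<beta> \<alpha> dvd 4" using 4 by (metis dvd_triv_left)
  then have "cor \<beta> \<alpha> \<le> 4" by (rule zdvd_imp_le) simp
  then have "cor \<beta> \<alpha> \<in> {1, 2, 3, 4}" using pos by auto
  moreover have "cor \<beta> \<alpha> \<noteq> 3" using dvd by auto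
  ultimately consider "cor \<beta> \<alpha> = 1" | "cor \<beta> \<alpha> = 2" | "cor \<beta> \<alpha> = 4" by auto
  then show ?thesis
  proof cases
    case 1
    then have n2: "n = m + m" using \<open>n * cor \<beta> \<alpha> = 2 * m\<close> by simp
    have "zscale m (\<alpha> + \<alpha> - \<beta>) = zscale m \<alpha> + zscale m \<alpha> - zscale m \<beta>"
      by (simp only: zscale_diff_right zscale_add_right)
    also have "\<dots> = 0" using eq by (simp only: n2 zscale_add) simp
    finally have "\<alpha> + \<alpha> = \<beta>" using torsion_free[of m "\<alpha> + \<alpha> - \<beta>"] nm(2) by auto
    then show ?thesis using reduced R by blast
  next
    case 2
    then have nm: "n = m" using \<open>n * cor \<beta> \<alpha> = 2 * m\<close> by simp
    have "zscale n (\<alpha> - \<beta>) = 0" using eq by (simp only: nm zscale_diff_right) simp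
    then show ?thesis using torsion_free[of n "\<alpha> - \<beta>"] n by auto
  next
    case 3
    then have m2: "m = n + n" using \<open>n * cor \<beta> \<alpha> = 2 * m\<close> by simp
    have "zscale n (\<alpha> - (\<beta> + \<beta>)) = zscale n \<alpha> - (zscale n \<beta> + zscale n \<beta>)"
      by (simp only: zscale_diff_right zscale_add_right)
    also have "\<dots> = 0" using eq by (simp only: m2 zscale_add) simp
    finally have "\<beta> + \<beta> = \<alpha>" using torsion_free[of n "\<alpha> - (\<beta> + \<beta>)"] n by auto
    then show ?thesis using reduced R by blast
  qed
qed

text \<open>Converts a linear relation between barred roots into one between the roots, at the price
  of a nonzero factor.\<close>

lemma zscale_bar: "\<exists>e. e \<noteq> 0 \<and> zscale 2 (bar x) = zscale e (x::'x)"
  using bar_cases[of x]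
proof
  assume "bar x = x"
  then show ?thesis by (intro exI[of _ 2]) simp
next
  assume "bar x + bar x = x"
  then show ?thesis by (intro exI[of _ 1]) (simp add: zscale_2)
qed

lemma positive_roots_bar_independent:
  assumes "positive_roots R P" "\<alpha> \<in> P" "\<beta> \<in> P" "\<alpha> \<noteq> \<beta>" "n \<noteq> 0"
  shows "zscale n (bar \<alpha>) \<noteq> zscale m (bar \<beta>)"
proof
  assume eq: "zscale n (bar \<alpha>) = zscale m (bar \<beta>)"
  obtain e e' where e: "e \<noteq> 0" "zscale 2 (bar \<alpha>) = zscale e \<alpha>" "zscale 2 (bar \<beta>) = zscale e' \<beta>"
    using zscale_bar by metis
  have "zscale (n * e) \<alpha> = zscale n (zscale 2 (bar \<alpha>))" by (simp add: e(2) zscale_zscale)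
  also have "\<dots> = zscale 2 (zscale n (bar \<alpha>))" by (simp add: zscale_zscale mult.commute)
  also have "\<dots> = zscale m (zscale 2 (bar \<beta>))" by (simp add: eq zscale_zscale mult.commute)
  also have "\<dots> = zscale (m * e') \<beta>" by (simp add: e(3) zscale_zscale)
  finally have "\<alpha> = \<beta>"
    by (rule positive_roots_proportional[OF assms(1-3)]) (use assms(5) e(1) in simp)
  then show False using assms(4) by blast
qed

end

section \<open>The Dunkl operators over the integers\<close>

lemma dvd_power_minus_1: "(t::'a::comm_ring_1) dvd u - 1 \<Longrightarrow> t dvd u ^ n - 1"
proof (induction n)
  case (Suc n)
  have "u ^ Suc n - 1 = u * (u ^ n - 1) + (u - 1)" by (simp add: algebra_simps)
  then show ?case using Suc by (metis dvd_add dvd_mult)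
qed simp

context root_datum
begin

text \<open>Apply \<open>g\<close> to the defining congruence: \<open>g\<close> carries
  \<open>bar\<close> to \<open>bar\<close>, and the multiplicity is invariant. The root \<gamma> may
  be negative, since a sign change keeps its reflection and alters
  \<open>1 - gexp (bar \<gamma>)\<close> only by a unit.\<close>

lemma quasi_invariants_weyl_dvd:
  assumes P: "positive_roots R P" and k: "weyl_invariant R cor P k"
    and p: "p \<in> quasi_invariants R cor P k" and g: "g \<in> W" and w: "w \<in> W"
    and \<gamma>: "\<gamma> \<in> R" "g \<gamma> \<in> P"
  shows "(1 - gexp (bar (g \<gamma>))) ^ (2 * k (g \<gamma>)) dvd frag_act g (p (refl \<gamma> \<circ> w) - p w)"
proof -
  \<comment> \<open>The positive one among \<gamma> and its negative, for which the definition of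
    quasi-invariance supplies the congruence.\<close>
  define \<delta> where "\<delta> = (if \<gamma> \<in> P then \<gamma> else - \<gamma>)"
  have \<delta>: "\<delta> \<in> P" "\<delta> = \<gamma> \<or> \<delta> = - \<gamma>"
    using positive_or_negative[OF P \<gamma>(1)] by (auto simp: \<delta>_def)
  have g_\<delta>: "g \<delta> = g \<gamma> \<or> g \<delta> = - g \<gamma>"
    using \<delta>(2) additive.minus[OF weyl_additive[OF g]] by auto
  then have k_eq: "k \<delta> = k (g \<gamma>)"
    using k g \<delta>(1) \<gamma>(2) by (auto simp: weyl_invariant_def)
  have "refl \<delta> = refl \<gamma>" using \<delta>(2) reflection_uminus[OF \<gamma>(1)] by auto
  then have "(1 - gexp (bar \<delta>)) ^ (2 * k \<delta>) dvd p (refl \<gamma> \<circ> w) - p w"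
    using p \<delta>(1) w by (auto simp: quasi_invariants_def)
  then have "frag_act g ((1 - gexp (bar \<delta>)) ^ (2 * k \<delta>)) dvd frag_act g (p (refl \<gamma> \<circ> w) - p w)"
    by (rule frag_act_dvd[OF weyl_additive[OF g]])
  also have "frag_act g ((1 - gexp (bar \<delta>)) ^ (2 * k \<delta>)) = (1 - gexp (bar (g \<delta>))) ^ (2 * k (g \<gamma>))"
    by (simp only: frag_act_power[OF weyl_additive[OF g]] frag_act_diff frag_act_1[OF weyl_additive[OF g]]
        frag_act_single bar_image[OF weyl_additive[OF g] weyl_bij[OF g]] k_eq)
  finally have dvd: "(1 - gexp (bar (g \<delta>))) ^ (2 * k (g \<gamma>)) dvd frag_act g (p (refl \<gamma> \<circ> w) - p w)" .
  have "(1 - gexp (bar (g \<gamma>)) :: 'x \<Rightarrow>\<^sub>0 int) dvd 1 - gexp (bar (g \<delta>))"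
    using g_\<delta>
  proof
    assume "g \<delta> = - g \<gamma>"
    then have "bar (g \<delta>) = - bar (g \<gamma>)" by (simp only: bar_uminus)
    moreover have "(1 - gexp (bar (g \<gamma>)) :: 'x \<Rightarrow>\<^sub>0 int) dvd
        - (gexp (0 + zscale (- 1) (bar (g \<gamma>))) - gexp 0)"
      by (simp only: dvd_minus_iff one_minus_gexp_dvd)
    ultimately show ?thesis by (simp add: zscale_minus)
  qed simp
  then show ?thesis using dvd dvd_power_same dvd_trans by blast
qed

text \<open>A reflection moves every character by a multiple of \<alpha>, hence of
  \<open>bar \<alpha>\<close>, so it acts trivially modulo
  \<open>1 - gexp (bar \<alpha>)\<close>.\<close>

lemma reflection_invariant_dvd:
  assumes "\<alpha> \<in> R"
  shows "(1 - gexp (bar \<alpha>)) dvd frag_act (refl \<alpha>) f - f"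
proof -
  obtain e where e: "\<alpha> = zscale e (bar \<alpha>)"
    using bar_cases[of \<alpha>] by (metis zscale_1 zscale_2)
  have "(1 - gexp (bar \<alpha>)) dvd frag_extend (\<lambda>x. frag_of (refl \<alpha> x)) f - frag_extend frag_of f"
  proof (rule frag_extend_diff_dvd)
    fix x
    have "refl \<alpha> x = x + zscale (- cor \<alpha> x * e) (bar \<alpha>)"
      unfolding reflection_def
      by (subst (2) e) (simp add: zscale_zscale zscale_minus)
    then show "(1 - gexp (bar \<alpha>) :: 'x \<Rightarrow>\<^sub>0 int) dvd gexp (refl \<alpha> x) - gexp x"
      by (simp only: one_minus_gexp_dvd)
  qed
  then show ?thesis by (simp add: frag_act_def flip: frag_expansion)
qed

lemma non_zero_divisor_root:
  "\<alpha> \<in> R \<Longrightarrow> non_zero_divisor (1 - gexp (bar \<alpha>) :: 'x \<Rightarrow>\<^sub>0 'c::comm_ring_1)"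
  by (rule non_zero_divisor_1_minus_gexp) (rule zscale_bar_nonzero)

text \<open>The leading terms of \<open>2\<partial>\<^sub>\<eta> d\<close> and of the \<open>\<beta>\<close>-summand cancel modulo \<open>(1 - e\<^sup>b)\<^sup>2\<^sup>k\<close>.\<close>

lemma leading_terms_cancel:
  fixes d Y :: "'x \<Rightarrow>\<^sub>0 int"
  assumes \<beta>: "\<beta> \<in> R" and \<eta>: "additive \<eta>" and k: "k > 0"
    and d: "(1 - gexp (bar \<beta>)) ^ (2 * k) dvd d"
    and Y: "(1 - gexp (bar \<beta>)) * Y = d + frag_act (refl \<beta>) d"
  shows "(1 - gexp (bar \<beta>)) ^ (2 * k) dvd
    2 * frag_deriv \<eta> d + Poly_Mapping.single 0 (int k * \<eta> (bar \<beta>)) * (1 + gexp (bar \<beta>)) * Y"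
proof -
  define b where "b = bar \<beta>"
  define e where "e = (gexp b :: 'x \<Rightarrow>\<^sub>0 int)"
  define t where "t = 1 - e"
  define u where "u = (gexp (- b) :: 'x \<Rightarrow>\<^sub>0 int) ^ (2 * k)"
  define c where "c = (Poly_Mapping.single 0 (\<eta> b) :: 'x \<Rightarrow>\<^sub>0 int)"
  let ?s = "frag_act (refl \<beta>)"
  \<comment> \<open>\<open>m\<close> is the exponent left after the loss of one power of
    \<open>t\<close>.\<close>
  obtain m where m: "2 * k = Suc m" using k by (cases "2 * k") auto
  have two_k: "(of_nat (Suc m) :: 'x \<Rightarrow>\<^sub>0 int) = 2 * of_nat k" by (simp flip: m)
  obtain q where q: "d = t ^ Suc m * q" using d by (auto simp: m t_def e_def b_def elim: dvdE)
  have nzd: "non_zero_divisor t" unfolding t_def e_def b_def by (rule non_zero_divisor_root[OF \<beta>])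
  \<comment> \<open>The reflection multiplies \<open>t\<close> by a unit; in the even power
    \<open>2 * k\<close> the sign disappears and the unit becomes \<open>u\<close>.\<close>
  have s_t: "?s t = (- gexp (- b)) * t"
    unfolding t_def e_def
    by (simp add: frag_act_diff frag_act_1[OF additive_reflection[OF \<beta>]] frag_act_single
        reflection_bar[OF \<beta>] b_def algebra_simps mult_single)
  have "?s d = ?s t ^ (2 * k) * ?s q"
    by (simp only: q m frag_act_mult[OF additive_reflection[OF \<beta>]] frag_act_power[OF additive_reflection[OF \<beta>]])
  also have "\<dots> = u * t ^ Suc m * ?s q"
    unfolding s_t power_mult_distrib u_def m[symmetric] by simp
  finally have s_d: "?s d = u * t ^ Suc m * ?s q" .
  have "t * Y = d + ?s d" using Y by (simp only: t_def e_def b_def)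
  also have "\<dots> = t ^ Suc m * q + u * t ^ Suc m * ?s q" by (simp only: s_d) (simp only: q)
  finally have "t * Y = t * (t ^ m * (q + u * ?s q))" by (simp add: algebra_simps)
  then have Y': "Y = t ^ m * (q + u * ?s q)"
    using non_zero_divisor_cancel[OF nzd] by (metis mult.commute)
  have "frag_deriv \<eta> t = - (c * e)"
    by (simp add: t_def e_def c_def frag_deriv_diff frag_deriv_1[OF \<eta>] frag_deriv_single mult_single)
  then have deriv_d: "frag_deriv \<eta> d = t ^ Suc m * frag_deriv \<eta> q - 2 * of_nat k * t ^ m * c * e * q"
    by (simp only: q frag_deriv_mult[OF \<eta>] frag_deriv_power[OF \<eta>] two_k) (simp add: algebra_simps)
  have coeff: "Poly_Mapping.single 0 (int k * \<eta> b) = of_nat k * c"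
    by (simp add: c_def mult_single flip: single_of_nat)
  have e_t: "e = 1 - t" by (simp add: t_def)
  \<comment> \<open>After \<open>e = 1 - t\<close>, the derivative contributes \<open>-4 * q\<close>
    and the \<beta>-term \<open>2 * (q + u * ?s q)\<close> at order \<open>t ^ m\<close>. Their sum
    gains the missing factor \<open>t\<close>, because \<open>u\<close> and the reflection are
    trivial modulo \<open>t\<close>.\<close>
  have eq: "2 * frag_deriv \<eta> d + Poly_Mapping.single 0 (int k * \<eta> b) * (1 + e) * Y =
      2 * t ^ Suc m * frag_deriv \<eta> q
      + of_nat k * c * (t ^ m * (2 * (u * ?s q - q) + t * (3 * q - u * ?s q)))"
    unfolding deriv_d coeff Y' e_t by (simp add: algebra_simps)
  have "t dvd gexp (0 + zscale (- 1) b) - gexp 0"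
    unfolding t_def e_def by (rule one_minus_gexp_dvd)
  then have "t dvd u - 1"
    unfolding u_def by (intro dvd_power_minus_1) (simp add: zscale_minus)
  moreover have "t dvd ?s q - q" using reflection_invariant_dvd[OF \<beta>] by (simp add: t_def e_def b_def)
  ultimately have "t dvd (u - 1) * ?s q + (?s q - q)" by (intro dvd_add dvd_mult2)
  then have "t dvd u * ?s q - q" by (simp add: algebra_simps)
  then have "t ^ m * t dvd t ^ m * (2 * (u * ?s q - q) + t * (3 * q - u * ?s q))"
    by (intro mult_dvd_mono dvd_add dvd_mult dvd_mult2 dvd_refl)
  then have "t ^ Suc m dvd of_nat k * c * (t ^ m * (2 * (u * ?s q - q) + t * (3 * q - u * ?s q)))"
    unfolding power_Suc2 by (rule dvd_mult)
  then have "t ^ Suc m dvd 2 * frag_deriv \<eta> d + Poly_Mapping.single 0 (int k * \<eta> b) * (1 + e) * Y"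
    unfolding eq by (intro dvd_add) simp_all
  then show ?thesis by (simp add: m t_def e_def b_def)
qed

text \<open>\<open>q\<close> is twice the Dunkl operator applied to \<open>p\<close>, the factor
  clearing the one half, and \<open>y\<close> holds the quotients of the difference terms. Quotients
  are claimed only where \<open>k \<alpha> > 0\<close>, since a zero multiplicity imposes no
  congruence.\<close>

lemma integral_dunkl:
  assumes P: "positive_roots R P" and k: "weyl_invariant R cor P k"
    and p: "p \<in> quasi_invariants R cor P k" and \<eta>: "additive \<eta>"
  obtains q y where "q \<in> quasi_invariants R cor P k"
    and "\<And>\<alpha> w. \<alpha> \<in> P \<Longrightarrow> w \<in> W \<Longrightarrow> k \<alpha> > 0 \<Longrightarrow>
      p w - frag_act (refl \<alpha>) (p (refl \<alpha> \<circ> w)) = (1 - gexp (bar \<alpha>)) * y \<alpha> w"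
    and "\<And>w. w \<in> W \<Longrightarrow> q w = 2 * frag_deriv \<eta> (p w) +
      (\<Sum>\<alpha>\<in>P. Poly_Mapping.single 0 (int (k \<alpha>) * \<eta> (bar \<alpha>)) * (1 + gexp (bar \<alpha>)) * y \<alpha> w)"
proof -
  have "\<exists>y. p w - frag_act (refl \<alpha>) (p (refl \<alpha> \<circ> w)) = (1 - gexp (bar \<alpha>)) * y"
    if \<alpha>: "\<alpha> \<in> P" and w: "w \<in> W" and k\<alpha>: "k \<alpha> > 0" for \<alpha> w
  proof -
    have R: "\<alpha> \<in> R" using \<alpha> P positive_roots_subset by blast
    have "(1 - gexp (bar \<alpha>)) ^ 1 dvd (1 - gexp (bar \<alpha>) :: 'x \<Rightarrow>\<^sub>0 int) ^ (2 * k \<alpha>)"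
      using k\<alpha> by (intro le_imp_power_dvd) simp
    also have "\<dots> dvd p (refl \<alpha> \<circ> w) - p w" using p \<alpha> w by (auto simp: quasi_invariants_def)
    finally have dvd: "(1 - gexp (bar \<alpha>)) dvd p (refl \<alpha> \<circ> w) - p w" by (simp only: power_one_right)
    have "(1 - gexp (bar \<alpha>)) dvd - (frag_act (refl \<alpha>) (p (refl \<alpha> \<circ> w)) - p (refl \<alpha> \<circ> w))"
      by (simp only: dvd_minus_iff reflection_invariant_dvd[OF R])
    from dvd_diff[OF this dvd]
    show ?thesis by (simp add: dvd_def)
  qed
  then obtain y where y: "\<And>\<alpha> w. \<alpha> \<in> P \<Longrightarrow> w \<in> W \<Longrightarrow> k \<alpha> > 0 \<Longrightarrow>
      p w - frag_act (refl \<alpha>) (p (refl \<alpha> \<circ> w)) = (1 - gexp (bar \<alpha>)) * y \<alpha> w"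
    by metis
  \<comment> \<open>\<open>c \<alpha>\<close> is zero when \<open>k \<alpha> = 0\<close>, so the
    unspecified values of \<open>y\<close> there do no harm.\<close>
  define c where "c \<alpha> = (Poly_Mapping.single 0 (int (k \<alpha>) * \<eta> (bar \<alpha>)) * (1 + gexp (bar \<alpha>)) :: 'x \<Rightarrow>\<^sub>0 int)" for \<alpha>
  define q where "q w = (if w \<in> W then 2 * frag_deriv \<eta> (p w) + (\<Sum>\<alpha>\<in>P. c \<alpha> * y \<alpha> w) else 0)" for w
  have "(1 - gexp (bar \<beta>)) ^ (2 * k \<beta>) dvd q (refl \<beta> \<circ> w) - q w" if \<beta>: "\<beta> \<in> P" and w: "w \<in> W" for \<beta> w
  proof (cases "k \<beta> = 0")
    case False
    let ?I = "(1 - gexp (bar \<beta>) :: 'x \<Rightarrow>\<^sub>0 int) ^ (2 * k \<beta>)"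
    have R: "\<beta> \<in> R" using \<beta> P positive_roots_subset by blast
    have sw: "refl \<beta> \<circ> w \<in> W" using R w by (rule weyl_reflection)
    define d where "d = p (refl \<beta> \<circ> w) - p w"
    have d: "?I dvd d" using p \<beta> w by (auto simp: quasi_invariants_def d_def)
    have other: "?I dvd c \<alpha> * (y \<alpha> (refl \<beta> \<circ> w) - y \<alpha> w)" if \<alpha>: "\<alpha> \<in> P - {\<beta>}" for \<alpha>
    proof (cases "k \<alpha> = 0")
      case False
      have R\<alpha>: "\<alpha> \<in> R" using \<alpha> P positive_roots_subset by blast
      define \<gamma> where "\<gamma> = refl \<alpha> \<beta>"
      have \<gamma>: "\<gamma> \<in> R" "refl \<alpha> \<gamma> = \<beta>" using R R\<alpha> by (simp_all add: \<gamma>_def reflection_root)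
      have comm: "refl \<gamma> \<circ> (refl \<alpha> \<circ> w) = refl \<alpha> \<circ> (refl \<beta> \<circ> w)"
        using reflection_weyl[OF reflection_weyl_group[OF R\<alpha>] R] by (metis \<gamma>_def comp_assoc)
      have "(1 - gexp (bar (refl \<alpha> \<gamma>))) ^ (2 * k (refl \<alpha> \<gamma>)) dvd
          frag_act (refl \<alpha>) (p (refl \<gamma> \<circ> (refl \<alpha> \<circ> w)) - p (refl \<alpha> \<circ> w))"
        using \<gamma> \<beta> weyl_reflection[OF R\<alpha> w]
        by (intro quasi_invariants_weyl_dvd[OF P k p reflection_weyl_group[OF R\<alpha>]]) simp_all
      \<comment> \<open>\<open>d\<close> is the change of \<open>p w\<close>, the other term the
        change of its reflected partner; both are divisible by \<open>?I\<close>, hence so is the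
        change of the numerator.\<close>
      then have "?I dvd d - frag_act (refl \<alpha>) (p (refl \<alpha> \<circ> (refl \<beta> \<circ> w)) - p (refl \<alpha> \<circ> w))"
        unfolding comm \<gamma>(2) by (rule dvd_diff[OF d])
      also have "\<dots> = (p (refl \<beta> \<circ> w) - frag_act (refl \<alpha>) (p (refl \<alpha> \<circ> (refl \<beta> \<circ> w))))
          - (p w - frag_act (refl \<alpha>) (p (refl \<alpha> \<circ> w)))"
        by (simp add: d_def frag_act_diff)
      also have "\<dots> = (1 - gexp (bar \<alpha>)) * (y \<alpha> (refl \<beta> \<circ> w) - y \<alpha> w)"
        using \<alpha> False w sw by (simp add: y right_diff_distrib)
      finally have dvd: "?I dvd (1 - gexp (bar \<alpha>)) * (y \<alpha> (refl \<beta> \<circ> w) - y \<alpha> w)" .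
      have "?I dvd y \<alpha> (refl \<beta> \<circ> w) - y \<alpha> w"
      proof (rule one_minus_gexp_power_coprime[OF _ _ dvd])
        show "zscale n (bar \<alpha>) \<noteq> zscale m (bar \<beta>)" if "n \<noteq> 0" for n m
          using positive_roots_bar_independent[OF P _ \<beta> _ that] \<alpha> by blast
      qed (rule zscale_bar_nonzero[OF R])
      then show ?thesis by (rule dvd_mult)
    qed (simp add: c_def)
    \<comment> \<open>For \<beta> itself the reflection swaps the two components, so the numerator
      changes by \<open>d\<close> plus its reflection, as \<open>leading_terms_cancel\<close>
      expects.\<close>
    have inv: "refl \<beta> \<circ> (refl \<beta> \<circ> w) = w" using R by auto
    have "(1 - gexp (bar \<beta>)) * (y \<beta> (refl \<beta> \<circ> w) - y \<beta> w) =
        (p (refl \<beta> \<circ> w) - frag_act (refl \<beta>) (p (refl \<beta> \<circ> (refl \<beta> \<circ> w))))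
        - (p w - frag_act (refl \<beta>) (p (refl \<beta> \<circ> w)))"
      using \<beta> False w sw by (simp add: y right_diff_distrib)
    also have "\<dots> = d + frag_act (refl \<beta>) d"
      by (simp only: inv) (simp add: d_def frag_act_diff)
    finally have lead: "?I dvd 2 * frag_deriv \<eta> d + c \<beta> * (y \<beta> (refl \<beta> \<circ> w) - y \<beta> w)"
      unfolding c_def using R \<eta> False d by (intro leading_terms_cancel) simp_all
    have "q (refl \<beta> \<circ> w) - q w = 2 * frag_deriv \<eta> d + (\<Sum>\<alpha>\<in>P. c \<alpha> * (y \<alpha> (refl \<beta> \<circ> w) - y \<alpha> w))"
      using w sw by (simp add: q_def d_def frag_deriv_diff right_diff_distrib sum_subtractf)
    also have "\<dots> = (2 * frag_deriv \<eta> d + c \<beta> * (y \<beta> (refl \<beta> \<circ> w) - y \<beta> w))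
        + (\<Sum>\<alpha>\<in>P - {\<beta>}. c \<alpha> * (y \<alpha> (refl \<beta> \<circ> w) - y \<alpha> w))"
      by (simp only: sum.remove[OF finite_positive_roots[OF P] \<beta>] add.assoc)
    finally have q_diff: "q (refl \<beta> \<circ> w) - q w = \<dots>" .
    show ?thesis unfolding q_diff
      by (rule dvd_add[OF lead]) (rule dvd_sum, rule other)
  qed simp
  then have "q \<in> quasi_invariants R cor P k" by (auto simp: quasi_invariants_def q_def)
  then show thesis using y by (rule that) (simp_all add: q_def c_def)
qed

end

section \<open>Families of Laurent polynomials in the localised module\<close>

definition of_ring :: "'a::comm_ring_1 \<Rightarrow> 'a tfrac" where
  "of_ring a = Frac a 1"

lemma of_ring_0: "of_ring 0 = 0" and of_ring_1: "of_ring 1 = 1"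
  by (simp_all add: of_ring_def Frac_0 Frac_1)

lemma of_ring_add: "of_ring (a + b) = of_ring a + of_ring b"
  by (simp add: of_ring_def Frac_add)

lemma of_ring_mult: "of_ring (a * b) = of_ring a * of_ring b"
  by (simp add: of_ring_def Frac_mult)

lemma of_ring_diff: "of_ring (a - b) = of_ring a - of_ring b"
  by (metis add_diff_cancel diff_add_cancel of_ring_add)

text \<open>How the pole of a Dunkl coefficient disappears: the term it multiplies contains the
  denominator as a factor.\<close>

lemma Frac_mult_of_ring:
  "non_zero_divisor s \<Longrightarrow> Frac a s * of_ring (s * b) = of_ring (a * b)"
  by (simp add: of_ring_def Frac_mult Frac_eq_iff ac_simps)

lemma scalar_of_ring: "scalar c = of_ring (Poly_Mapping.single 0 c)"
  by (simp add: scalar_def of_ring_def)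

lemma scalar_0 [simp]: "scalar 0 = 0"
  and scalar_add: "scalar (a + b) = scalar a + scalar b"
  and scalar_mult: "scalar (a * b) = scalar a * scalar b"
  by (simp_all add: scalar_of_ring of_ring_0 single_add of_ring_add mult_single flip: of_ring_mult)

lemma scalar_1: "scalar 1 = 1"
  by (simp add: scalar_of_ring of_ring_1)

section \<open>Extension of coefficients from the integers to the field\<close>

abbreviation map_of_int :: "('x \<Rightarrow>\<^sub>0 int) \<Rightarrow> 'x \<Rightarrow>\<^sub>0 'k::field_char_0" where
  "map_of_int \<equiv> Poly_Mapping.map of_int"

lemma incl_of_ring: "incl p = of_ring (map_of_int p)"
  by (simp add: incl_def of_ring_def)

lemma lookup_map_of_int: "Poly_Mapping.lookup (map_of_int p) x = of_int (Poly_Mapping.lookup p x)"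
  by (simp add: Poly_Mapping.map.rep_eq when_def)

lemma map_of_int_0: "map_of_int 0 = 0"
  and map_of_int_add: "map_of_int (p + q) = map_of_int p + map_of_int q"
  and map_of_int_diff: "map_of_int (p - q) = map_of_int p - map_of_int q"
  by (rule poly_mapping_eqI; simp add: lookup_map_of_int lookup_add lookup_minus)+

lemma map_of_int_single: "map_of_int (Poly_Mapping.single x c) = Poly_Mapping.single x (of_int c)"
  by (rule poly_mapping_eqI) (simp add: lookup_map_of_int lookup_single when_def)

lemma map_of_int_mult:
  fixes p q :: "'x::ab_group_add \<Rightarrow>\<^sub>0 int"
  shows "map_of_int (p * q) = map_of_int p * map_of_int q"
proof (induction p rule: poly_mapping_additive_induct)
  case (1 x c)
  show ?case
    by (induction q rule: poly_mapping_additive_induct)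
      (simp_all add: mult_single map_of_int_single map_of_int_add map_of_int_0 distrib_left)
qed (simp_all add: map_of_int_add map_of_int_0 distrib_right)

lemma incl_0: "incl 0 = 0"
  and incl_add: "incl (p + q) = incl p + incl q"
  and incl_diff: "incl (p - q) = incl p - incl q"
  and incl_mult: "incl (p * q) = incl p * incl q"
  by (simp_all add: incl_of_ring map_of_int_0 map_of_int_add map_of_int_diff map_of_int_mult
      of_ring_0 of_ring_add of_ring_diff of_ring_mult)

lemma incl_sum: "incl (\<Sum>i\<in>I. p i) = (\<Sum>i\<in>I. incl (p i))"
  by (induction I rule: infinite_finite_induct) (simp_all add: incl_0 incl_add)

lemma incl_single_0: "incl (Poly_Mapping.single 0 c) = scalar (of_int c)"
  by (simp add: incl_of_ring scalar_of_ring map_of_int_single)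

lemma map_of_int_1: "map_of_int 1 = (1 :: 'x::ab_group_add \<Rightarrow>\<^sub>0 'k::field_char_0)"
  using map_of_int_single[of "0::'x" 1] by simp

lemma lattice_act_map_of_int: "lattice_act g (map_of_int p) = map_of_int (frag_act g p)"
  by (induction p rule: poly_mapping_additive_induct)
    (simp_all add: map_of_int_single map_of_int_add map_of_int_0 lattice_act_single lattice_act_add
      frag_act_single frag_act_add, simp add: lattice_act_def)

lemma lattice_deriv_map_of_int:
  "lattice_deriv (\<lambda>x. of_int (\<eta> x)) (map_of_int p) = map_of_int (frag_deriv \<eta> p)"
  by (induction p rule: poly_mapping_additive_induct)
    (simp_all add: map_of_int_single map_of_int_add map_of_int_0 lattice_deriv_single lattice_deriv_add
      frag_deriv_single frag_deriv_add, simp add: lattice_deriv_def)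

lemma lattice_act_scale:
  "additive g \<Longrightarrow> lattice_act g (Poly_Mapping.single 0 c * p) = Poly_Mapping.single 0 c * lattice_act g p"
  by (simp add: lattice_act_mult lattice_act_single additive.zero)

lemma lattice_deriv_scale:
  "additive \<xi> \<Longrightarrow>
    lattice_deriv \<xi> (Poly_Mapping.single 0 c * p) = Poly_Mapping.single 0 c * lattice_deriv \<xi> p"
  by (simp add: lattice_deriv_mult lattice_deriv_single additive.zero)

lemma lattice_deriv_plus:
  "lattice_deriv (\<lambda>x. \<xi> x + \<zeta> x) p = lattice_deriv \<xi> p + lattice_deriv \<zeta> p"
  by (simp add: lattice_deriv_def sum.distrib distrib_right single_add)

lemma lattice_deriv_times:
  "lattice_deriv (\<lambda>x. c * \<xi> x) p = Poly_Mapping.single 0 c * lattice_deriv \<xi> p"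
  by (simp add: lattice_deriv_def sum_distrib_left mult_single mult.assoc)

section \<open>The operators on Laurent polynomials\<close>

lemma ring_act_of_ring:
  assumes "additive g" "bij g"
  shows "ring_act g (of_ring p) = of_ring (lattice_act g p)"
proof -
  have "lattice_act g (1 :: 'a \<Rightarrow>\<^sub>0 'b) = 1"
    using lattice_act_single[of g 0 "1::'b"] additive.zero[OF assms(1)] by simp
  then show ?thesis by (simp add: of_ring_def ring_act_Frac[OF assms])
qed

lemma partial_deriv_of_ring:
  fixes \<xi> :: "'x::ab_group_add \<Rightarrow> 'k::field_char_0"
  assumes "additive \<xi>"
  shows "partial_deriv \<xi> (of_ring p) = of_ring (lattice_deriv \<xi> p)"
proof -
  have "lattice_deriv \<xi> (1 :: 'x \<Rightarrow>\<^sub>0 'k) = 0"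
    using lattice_deriv_single[of \<xi> 0 "1::'k"] additive.zero[OF assms] by simp
  then show ?thesis by (simp add: of_ring_def partial_deriv_Frac[OF assms])
qed

text \<open>On components from the group ring, \<open>tfrac_aut\<close> and
  \<open>tfrac_deriv\<close> reduce to explicit Laurent polynomial operators, so linearity is proved
  on these families, which contain the quasi-invariants.\<close>

definition ring_families :: "('w \<Rightarrow> 'a::comm_ring_1 tfrac) set" where
  "ring_families = {f. \<forall>w. f w \<in> range of_ring}"

text \<open>Relative to a set, because a restricted operator takes the value
  \<open>undefined\<close> outside its domain, where linearity can fail.\<close>

definition linear_on ::
    "(('w \<Rightarrow> ('x::ab_group_add \<Rightarrow>\<^sub>0 'k::field_char_0) tfrac) \<Rightarrow> 'w \<Rightarrow> ('x \<Rightarrow>\<^sub>0 'k) tfrac) \<Rightarrow>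
     ('w \<Rightarrow> ('x \<Rightarrow>\<^sub>0 'k) tfrac) set \<Rightarrow> bool" where
  "linear_on T N \<longleftrightarrow>
     (\<forall>u\<in>N. \<forall>v\<in>N. T (u + v) = T u + T v) \<and> (\<forall>c. \<forall>u\<in>N. T (kscale c u) = kscale c (T u))"

lemma linear_on_subset: "linear_on T N \<Longrightarrow> N' \<subseteq> N \<Longrightarrow> linear_on T N'"
  unfolding linear_on_def by blast

lemma subspace_ring_families:
  "module.subspace kscale (ring_families :: ('w \<Rightarrow> ('x::ab_group_add \<Rightarrow>\<^sub>0 'k::field_char_0) tfrac) set)"
  unfolding module.subspace_def[OF module_kscale] ring_families_def kscale_def scalar_of_ring
  by (auto simp: image_iff zero_fun_def) (metis of_ring_0 of_ring_add of_ring_mult)+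

lemma ring_act_add:
  assumes g: "additive g" "bij g" and "x \<in> range of_ring" "y \<in> range of_ring"
  shows "ring_act g (x + y) = ring_act g x + ring_act g y"
  using assms(3,4) by (auto simp: ring_act_of_ring[OF g] lattice_act_add simp flip: of_ring_add)

lemma ring_act_scalar_mult:
  assumes g: "additive g" "bij g" and "x \<in> range of_ring"
  shows "ring_act g (scalar c * x) = scalar c * ring_act g x"
  using assms(3)
  by (auto simp: ring_act_of_ring[OF g] scalar_of_ring lattice_act_scale[OF g(1)] simp flip: of_ring_mult)

lemma partial_deriv_add:
  assumes \<xi>: "additive \<xi>" and "x \<in> range of_ring" "y \<in> range of_ring"
  shows "partial_deriv \<xi> (x + y) = partial_deriv \<xi> x + partial_deriv \<xi> y"
  using assms(2,3) by (auto simp: partial_deriv_of_ring[OF \<xi>] lattice_deriv_add simp flip: of_ring_add)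

lemma partial_deriv_scalar_mult:
  assumes \<xi>: "additive \<xi>" and "x \<in> range of_ring"
  shows "partial_deriv \<xi> (scalar c * x) = scalar c * partial_deriv \<xi> x"
  using assms(2)
  by (auto simp: partial_deriv_of_ring[OF \<xi>] scalar_of_ring lattice_deriv_scale[OF \<xi>] simp flip: of_ring_mult)

lemma linear_on_mult_op: "linear_on (mult_op p) N"
  by (auto simp: linear_on_def mult_op_def kscale_def fun_eq_iff algebra_simps)

context root_datum
begin

lemma linear_on_weyl_op:
  assumes "g \<in> W"
  shows "linear_on (weyl_op g :: _ \<Rightarrow> _ \<Rightarrow> ('x \<Rightarrow>\<^sub>0 'k::field_char_0) tfrac) ring_families"
  using assms
  by (auto simp: linear_on_def ring_families_def weyl_op_def kscale_def fun_eq_iff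
      ring_act_add ring_act_scalar_mult weyl_additive weyl_bij)

lemma linear_on_dunkl_op:
  assumes P: "positive_roots R P" and \<xi>: "additive \<xi>"
  shows "linear_on (dunkl_op R cor P k \<xi> :: _ \<Rightarrow> _ \<Rightarrow> ('x \<Rightarrow>\<^sub>0 'k::field_char_0) tfrac) ring_families"
proof -
  let ?A = "\<lambda>\<alpha>. scalar (of_nat (k \<alpha>) * \<xi> (bar \<alpha>)) * Frac (1 + gexp (bar \<alpha>)) (1 - gexp (bar \<alpha>)) :: ('x \<Rightarrow>\<^sub>0 'k) tfrac"
  have r: "additive (refl \<alpha>)" "bij (refl \<alpha>)" if "\<alpha> \<in> P" for \<alpha>
    using that positive_roots_subset[OF P] additive_reflection bij_reflection by blast+
  have "dunkl_op R cor P k \<xi> (u + v) = dunkl_op R cor P k \<xi> u + dunkl_op R cor P k \<xi> v"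
    if u: "u \<in> ring_families" and v: "v \<in> ring_families" for u v :: "_ \<Rightarrow> ('x \<Rightarrow>\<^sub>0 'k) tfrac"
  proof -
    have "(\<Sum>\<alpha>\<in>P. ?A \<alpha> * (u w + v w - ring_act (refl \<alpha>) (u (refl \<alpha> \<circ> w) + v (refl \<alpha> \<circ> w)))) =
        (\<Sum>\<alpha>\<in>P. ?A \<alpha> * (u w - ring_act (refl \<alpha>) (u (refl \<alpha> \<circ> w)))) +
        (\<Sum>\<alpha>\<in>P. ?A \<alpha> * (v w - ring_act (refl \<alpha>) (v (refl \<alpha> \<circ> w))))" for w
      unfolding sum.distrib[symmetric] using u v
      by (intro sum.cong refl)
        (simp add: ring_families_def ring_act_add[OF r] r right_diff_distrib distrib_left)
    then show ?thesis using u v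
      by (auto simp: dunkl_op_def fun_eq_iff partial_deriv_add[OF \<xi>] ring_families_def distrib_left)
  qed
  moreover have "dunkl_op R cor P k \<xi> (kscale c u) = kscale c (dunkl_op R cor P k \<xi> u)"
    if u: "u \<in> ring_families" for c and u :: "_ \<Rightarrow> ('x \<Rightarrow>\<^sub>0 'k) tfrac"
  proof -
    have "(\<Sum>\<alpha>\<in>P. ?A \<alpha> * (scalar c * u w - ring_act (refl \<alpha>) (scalar c * u (refl \<alpha> \<circ> w)))) =
        scalar c * (\<Sum>\<alpha>\<in>P. ?A \<alpha> * (u w - ring_act (refl \<alpha>) (u (refl \<alpha> \<circ> w))))" for w
      unfolding sum_distrib_left using u
      by (intro sum.cong refl)
        (simp add: ring_families_def ring_act_scalar_mult[OF r] algebra_simps)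
    then show ?thesis using u
      by (auto simp: dunkl_op_def kscale_def fun_eq_iff partial_deriv_scalar_mult[OF \<xi>] ring_families_def
          algebra_simps)
  qed
  ultimately show ?thesis by (simp add: linear_on_def)
qed

text \<open>Together with \<open>dunkl_op_times\<close>, this gives linearity in the functional,
  through which the integral case yields all others.\<close>

lemma dunkl_op_plus:
  assumes "additive \<xi>" "additive \<zeta>" and u: "u \<in> ring_families"
  shows "dunkl_op R cor P k (\<lambda>x. \<xi> x + \<zeta> x) u =
    (dunkl_op R cor P k \<xi> u + dunkl_op R cor P k \<zeta> u :: _ \<Rightarrow> ('x \<Rightarrow>\<^sub>0 'k::field_char_0) tfrac)"
proof
  fix w
  obtain a where "u w = of_ring a" using u by (auto simp: ring_families_def)
  moreover have "additive (\<lambda>x. \<xi> x + \<zeta> x)" using assms by (auto simp: additive_def)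
  ultimately show "dunkl_op R cor P k (\<lambda>x. \<xi> x + \<zeta> x) u w =
      (dunkl_op R cor P k \<xi> u + dunkl_op R cor P k \<zeta> u) w"
    using assms
    by (simp add: dunkl_op_def partial_deriv_of_ring lattice_deriv_plus of_ring_add distrib_left
        distrib_right scalar_add sum.distrib)
qed

lemma dunkl_op_times:
  assumes "additive \<xi>" and u: "u \<in> ring_families"
  shows "dunkl_op R cor P k (\<lambda>x. c * \<xi> x) u =
    (kscale c (dunkl_op R cor P k \<xi> u) :: _ \<Rightarrow> ('x \<Rightarrow>\<^sub>0 'k::field_char_0) tfrac)"
proof
  fix w
  obtain a where a: "u w = of_ring a" using u by (auto simp: ring_families_def)
  have "additive (\<lambda>x. c * \<xi> x)" using assms by (simp add: additive_def distrib_left)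
  then have deriv: "partial_deriv (\<lambda>x. c * \<xi> x) (u w) = scalar c * partial_deriv \<xi> (u w)"
    unfolding a
    by (simp only: partial_deriv_of_ring assms(1) lattice_deriv_times of_ring_mult scalar_of_ring)
  have sum: "(\<Sum>\<alpha>\<in>P. scalar (of_nat (k \<alpha>) * (c * \<xi> (bar \<alpha>))) * F \<alpha> * D \<alpha>) =
      scalar c * (\<Sum>\<alpha>\<in>P. scalar (of_nat (k \<alpha>) * \<xi> (bar \<alpha>)) * F \<alpha> * D \<alpha>)"
    for F D :: "_ \<Rightarrow> ('x \<Rightarrow>\<^sub>0 'k) tfrac"
    unfolding sum_distrib_left by (intro sum.cong refl) (simp only: scalar_mult ac_simps)
  show "dunkl_op R cor P k (\<lambda>x. c * \<xi> x) u w = kscale c (dunkl_op R cor P k \<xi> u) w"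
  proof (cases "w \<in> W")
    case True
    show ?thesis
      unfolding dunkl_op_def kscale_def if_P[OF True] deriv sum
      by (simp only: distrib_left ac_simps)
  qed (simp add: dunkl_op_def kscale_def)
qed

end

section \<open>Stability of the quasi-invariants\<close>

lemma subspace_quasi_invariants_k: "module.subspace kscale (quasi_invariants_k R cor P k)"
  unfolding quasi_invariants_k_def by (rule module.subspace_span[OF module_kscale])

lemma incl_quasi_invariants_k:
  "p \<in> quasi_invariants R cor P k \<Longrightarrow> incl \<circ> p \<in> quasi_invariants_k R cor P k"
  unfolding quasi_invariants_k_def by (rule module.span_base[OF module_kscale]) blast

lemma quasi_invariants_k_subset_ring_families:
  "quasi_invariants_k R cor P k \<subseteq> (ring_families :: (_ \<Rightarrow> ('x::ab_group_add \<Rightarrow>\<^sub>0 'k::field_char_0) tfrac) set)"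
  unfolding quasi_invariants_k_def
  by (rule module.span_minimal[OF module_kscale _ subspace_ring_families])
    (auto simp: ring_families_def incl_of_ring)

lemma quasi_invariants_k_eq_0:
  assumes f: "f \<in> quasi_invariants_k R cor P k" and "w \<notin> weyl_group R cor"
  shows "f w = (0 :: ('x::ab_group_add \<Rightarrow>\<^sub>0 'k::field_char_0) tfrac)"
proof -
  have "module.subspace kscale {f :: _ \<Rightarrow> ('x \<Rightarrow>\<^sub>0 'k) tfrac. f w = 0}"
    by (simp add: module.subspace_def[OF module_kscale] kscale_def)
  then have "quasi_invariants_k R cor P k \<subseteq> {f :: _ \<Rightarrow> ('x \<Rightarrow>\<^sub>0 'k) tfrac. f w = 0}"
    unfolding quasi_invariants_k_def using assms(2)
    by (intro module.span_minimal[OF module_kscale]) (auto simp: quasi_invariants_def incl_0)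
  then show ?thesis using f by blast
qed

lemma quasi_invariants_k_subset_regular_module:
  "quasi_invariants_k R cor P k \<subseteq>
    (regular_module R cor P :: (_ \<Rightarrow> ('x::ab_group_add \<Rightarrow>\<^sub>0 'k::field_char_0) tfrac) set)"
proof
  fix f :: "_ \<Rightarrow> ('x \<Rightarrow>\<^sub>0 'k) tfrac"
  assume f: "f \<in> quasi_invariants_k R cor P k"
  have "f w \<in> regular_ring P" for w
  proof -
    obtain a where "f w = of_ring a"
      using subsetD[OF quasi_invariants_k_subset_ring_families f] by (auto simp: ring_families_def)
    \<comment> \<open>A Laurent polynomial is the fraction whose denominator has all exponents
      zero.\<close>
    then have "f w = Frac a (\<Prod>\<alpha>\<in>P. (1 - gexp \<alpha>) ^ 0)" by (simp add: of_ring_def)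
    then show ?thesis unfolding regular_ring_def by (intro CollectI exI[of _ a] exI[of _ "\<lambda>_. 0"]) simp
  qed
  then show "f \<in> regular_module R cor P"
    using f quasi_invariants_k_eq_0 by (auto simp: regular_module_def)
qed

text \<open>The elements of the span that \<open>T\<close> maps back into the span form a subspace,
  so the integral generators suffice.\<close>

lemma quasi_invariants_k_stable:
  assumes T: "linear_on T ring_families"
    and incl: "\<And>p. p \<in> quasi_invariants R cor P k \<Longrightarrow> T (incl \<circ> p) \<in> quasi_invariants_k R cor P k"
    and f: "f \<in> quasi_invariants_k R cor P k"
  shows "T f \<in> quasi_invariants_k R cor P k"
proof -
  let ?Q = "quasi_invariants_k R cor P k"
  have Q: "linear_on T ?Q" using T quasi_invariants_k_subset_ring_families by (rule linear_on_subset)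
  note S = subspace_quasi_invariants_k[of R cor P k, unfolded module.subspace_def[OF module_kscale]]
  \<comment> \<open>The value at zero comes from compatibility with the scalar
    \<open>0\<close>.\<close>
  have "T (kscale 0 0) = kscale 0 (T 0)" using Q S unfolding linear_on_def by blast
  then have "T 0 = 0" by (simp add: kscale_def zero_fun_def)
  then have "module.subspace kscale {f \<in> ?Q. T f \<in> ?Q}"
    using Q S unfolding module.subspace_def[OF module_kscale] linear_on_def by auto
  then have "?Q \<subseteq> {f \<in> ?Q. T f \<in> ?Q}"
    unfolding quasi_invariants_k_def[of R cor P k]
    using incl incl_quasi_invariants_k[of _ R cor P k]
    by (intro module.span_minimal[OF module_kscale]) (auto simp: quasi_invariants_k_def)
  then show ?thesis using f by blast
qed

lemma mult_op_quasi_invariants_k: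
  assumes "f \<in> quasi_invariants_k R cor P k"
  shows "mult_op a f \<in> quasi_invariants_k R cor P k"
proof (rule quasi_invariants_k_stable[OF linear_on_mult_op _ assms])
  fix p assume "p \<in> quasi_invariants R cor P k"
  then have "(\<lambda>w. a * p w) \<in> quasi_invariants R cor P k"
    by (auto simp: quasi_invariants_def simp flip: right_diff_distrib)
  moreover have "mult_op a (incl \<circ> p) = incl \<circ> (\<lambda>w. a * p w)"
    by (simp add: mult_op_def fun_eq_iff incl_mult)
  ultimately show "mult_op a (incl \<circ> p) \<in> quasi_invariants_k R cor P k"
    using incl_quasi_invariants_k by metis
qed

context root_datum
begin

lemma weyl_op_quasi_invariants_k:
  fixes f :: "_ \<Rightarrow> ('x \<Rightarrow>\<^sub>0 'k::field_char_0) tfrac"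
  assumes P: "positive_roots R P" and k: "weyl_invariant R cor P k" and g: "g \<in> W"
    and f: "f \<in> quasi_invariants_k R cor P k"
  shows "weyl_op g f \<in> quasi_invariants_k R cor P k"
proof (rule quasi_invariants_k_stable[OF linear_on_weyl_op[OF g] _ f])
  fix p assume p: "p \<in> quasi_invariants R cor P k"
  define q where "q w = frag_act g (p (inv g \<circ> w))" for w
  have "(1 - gexp (bar \<beta>)) ^ (2 * k \<beta>) dvd q (refl \<beta> \<circ> w) - q w" if \<beta>: "\<beta> \<in> P" and w: "w \<in> W" for \<beta> w
  proof -
    have R: "\<beta> \<in> R" using \<beta> P positive_roots_subset by blast
    \<comment> \<open>Moving \<open>refl \<beta>\<close> past \<open>inv g\<close> turns it into the
      reflection in this root, so the congruence for \<beta> is the \<open>g\<close>-image of the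
      one for \<gamma>.\<close>
    define \<gamma> where "\<gamma> = inv g \<beta>"
    have \<gamma>: "\<gamma> \<in> R" "g \<gamma> = \<beta>"
      using weyl_root[OF weyl_inv[OF g] R] weyl_bij[OF g] by (simp_all add: \<gamma>_def bij_is_surj surj_f_inv_f)
    have "refl \<gamma> \<circ> (inv g \<circ> w) = inv g \<circ> (refl \<beta> \<circ> w)"
      using reflection_weyl[OF weyl_inv[OF g] R] by (metis \<gamma>_def comp_assoc)
    moreover have "(1 - gexp (bar (g \<gamma>))) ^ (2 * k (g \<gamma>)) dvd
        frag_act g (p (refl \<gamma> \<circ> (inv g \<circ> w)) - p (inv g \<circ> w))"
      using \<gamma> \<beta> weyl_comp[OF weyl_inv[OF g] w]
      by (intro quasi_invariants_weyl_dvd[OF P k p g]) simp_all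
    ultimately show ?thesis by (simp add: q_def \<gamma>(2) frag_act_diff)
  qed
  moreover have "q w = 0" if "w \<notin> W" for w
    using that p weyl_comp_iff[OF weyl_inv[OF g]] by (simp add: q_def quasi_invariants_def)
  ultimately have "q \<in> quasi_invariants R cor P k" by (simp add: quasi_invariants_def)
  moreover have "weyl_op g (incl \<circ> p) = (incl \<circ> q :: _ \<Rightarrow> ('x \<Rightarrow>\<^sub>0 'k) tfrac)"
    by (simp add: weyl_op_def fun_eq_iff q_def incl_of_ring ring_act_of_ring weyl_additive weyl_bij g
        lattice_act_map_of_int)
  ultimately show "weyl_op g (incl \<circ> p :: _ \<Rightarrow> ('x \<Rightarrow>\<^sub>0 'k) tfrac) \<in> quasi_invariants_k R cor P k"
    using incl_quasi_invariants_k by metis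
qed

text \<open>Extends \<open>integral_dunkl\<close> to the field: on an integral generator the
  operator gives one half of the integral quasi-invariant \<open>q\<close>.\<close>

lemma dunkl_op_integral:
  fixes f :: "_ \<Rightarrow> ('x \<Rightarrow>\<^sub>0 'k::field_char_0) tfrac"
  assumes P: "positive_roots R P" and k: "weyl_invariant R cor P k" and \<eta>: "additive \<eta>"
    and f: "f \<in> quasi_invariants_k R cor P k"
  shows "dunkl_op R cor P k (\<lambda>x. of_int (\<eta> x)) f \<in> quasi_invariants_k R cor P k"
proof (rule quasi_invariants_k_stable[OF linear_on_dunkl_op[OF P] _ f])
  let ?\<xi> = "\<lambda>x. of_int (\<eta> x) :: 'k"
  show \<xi>: "additive ?\<xi>" using \<eta> by (simp add: additive_def)
  fix p assume p: "p \<in> quasi_invariants R cor P k"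
  obtain q y where q: "q \<in> quasi_invariants R cor P k"
    and y: "\<And>\<alpha> w. \<alpha> \<in> P \<Longrightarrow> w \<in> W \<Longrightarrow> k \<alpha> > 0 \<Longrightarrow>
      p w - frag_act (refl \<alpha>) (p (refl \<alpha> \<circ> w)) = (1 - gexp (bar \<alpha>)) * y \<alpha> w"
    and q_eq: "\<And>w. w \<in> W \<Longrightarrow> q w = 2 * frag_deriv \<eta> (p w) +
      (\<Sum>\<alpha>\<in>P. Poly_Mapping.single 0 (int (k \<alpha>) * \<eta> (bar \<alpha>)) * (1 + gexp (bar \<alpha>)) * y \<alpha> w)"
    using integral_dunkl[OF P k p \<eta>] by blast
  have "dunkl_op R cor P k ?\<xi> (incl \<circ> p) w = kscale (1/2) (incl \<circ> q) w" for w
  proof (cases "w \<in> W")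
    case True
    have summand: "scalar (of_nat (k \<alpha>) * ?\<xi> (bar \<alpha>)) * Frac (1 + gexp (bar \<alpha>)) (1 - gexp (bar \<alpha>)) *
        (incl (p w) - ring_act (refl \<alpha>) (incl (p (refl \<alpha> \<circ> w)))) =
        incl (Poly_Mapping.single 0 (int (k \<alpha>) * \<eta> (bar \<alpha>)) * (1 + gexp (bar \<alpha>)) * y \<alpha> w)"
      if \<alpha>: "\<alpha> \<in> P" for \<alpha>
    \<comment> \<open>For zero multiplicity both sides vanish, whatever \<open>y\<close> is.\<close>
    proof (cases "k \<alpha> = 0")
      case False
      have R: "\<alpha> \<in> R" using \<alpha> P positive_roots_subset by blast
      have "incl (p w) - ring_act (refl \<alpha>) (incl (p (refl \<alpha> \<circ> w))) =
          (incl (p w - frag_act (refl \<alpha>) (p (refl \<alpha> \<circ> w))) :: ('x \<Rightarrow>\<^sub>0 'k) tfrac)"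
        by (simp add: incl_diff)
          (simp add: incl_of_ring ring_act_of_ring additive_reflection[OF R] bij_reflection[OF R]
            lattice_act_map_of_int)
      also have "\<dots> = incl ((1 - gexp (bar \<alpha>)) * y \<alpha> w)"
        using y[OF \<alpha> True] False by simp
      also have "\<dots> = of_ring ((1 - gexp (bar \<alpha>)) * map_of_int (y \<alpha> w))"
        by (simp add: incl_of_ring map_of_int_mult map_of_int_diff map_of_int_1 map_of_int_single)
      finally have "incl (p w) - ring_act (refl \<alpha>) (incl (p (refl \<alpha> \<circ> w))) =
          (of_ring ((1 - gexp (bar \<alpha>)) * map_of_int (y \<alpha> w)) :: ('x \<Rightarrow>\<^sub>0 'k) tfrac)" .
      then have "Frac (1 + gexp (bar \<alpha>)) (1 - gexp (bar \<alpha>)) *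
          (incl (p w) - ring_act (refl \<alpha>) (incl (p (refl \<alpha> \<circ> w)))) =
          (of_ring ((1 + gexp (bar \<alpha>)) * map_of_int (y \<alpha> w)) :: ('x \<Rightarrow>\<^sub>0 'k) tfrac)"
        by (simp only: Frac_mult_of_ring[OF non_zero_divisor_root[OF R]])
      also have "\<dots> = incl ((1 + gexp (bar \<alpha>)) * y \<alpha> w)"
        by (simp add: incl_of_ring map_of_int_mult map_of_int_add map_of_int_1 map_of_int_single)
      finally show ?thesis
        by (simp only: mult.assoc incl_mult incl_single_0) simp
    qed (simp add: incl_0)
    have "incl (q w) = 2 * partial_deriv ?\<xi> (incl (p w)) +
        (\<Sum>\<alpha>\<in>P. scalar (of_nat (k \<alpha>) * ?\<xi> (bar \<alpha>)) * Frac (1 + gexp (bar \<alpha>)) (1 - gexp (bar \<alpha>)) *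
          (incl (p w) - ring_act (refl \<alpha>) (incl (p (refl \<alpha> \<circ> w)))))"
    proof -
      have "partial_deriv ?\<xi> (incl (p w)) = (incl (frag_deriv \<eta> (p w)) :: ('x \<Rightarrow>\<^sub>0 'k) tfrac)"
        by (simp only: incl_of_ring partial_deriv_of_ring[OF \<xi>] lattice_deriv_map_of_int)
      moreover have "(\<Sum>\<alpha>\<in>P. scalar (of_nat (k \<alpha>) * ?\<xi> (bar \<alpha>)) *
          Frac (1 + gexp (bar \<alpha>)) (1 - gexp (bar \<alpha>)) *
          (incl (p w) - ring_act (refl \<alpha>) (incl (p (refl \<alpha> \<circ> w))))) =
          (incl (\<Sum>\<alpha>\<in>P. Poly_Mapping.single 0 (int (k \<alpha>) * \<eta> (bar \<alpha>)) * (1 + gexp (bar \<alpha>)) * y \<alpha> w)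
            :: ('x \<Rightarrow>\<^sub>0 'k) tfrac)"
        unfolding incl_sum by (rule sum.cong[OF refl summand])
      ultimately show ?thesis by (simp only: q_eq[OF True] incl_add mult_2)
    qed
    moreover have "scalar (1/2) * (2 * x) = x" for x :: "('x \<Rightarrow>\<^sub>0 'k) tfrac"
    proof -
      have "scalar (1/2) * (2 * x) = (scalar (1/2) + scalar (1/2)) * x"
        by (simp only: mult_2 distrib_left distrib_right)
      also have "\<dots> = x" by (simp add: scalar_1 flip: scalar_add)
      finally show ?thesis .
    qed
    ultimately show ?thesis
      unfolding dunkl_op_def kscale_def if_P[OF True] comp_apply by (simp only: distrib_left)
  next
    case False
    then show ?thesis using q by (simp add: dunkl_op_def kscale_def quasi_invariants_def incl_0)
  qed
  then have "dunkl_op R cor P k ?\<xi> (incl \<circ> p) = kscale (1/2) (incl \<circ> q)" by (rule ext)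
  then show "dunkl_op R cor P k ?\<xi> (incl \<circ> p) \<in> quasi_invariants_k R cor P k"
    using module.subspace_scale[OF module_kscale subspace_quasi_invariants_k incl_quasi_invariants_k[OF q]]
    by (simp only:)
qed

text \<open>Every functional is a \<open>k\<close>-linear combination of integral ones, by expanding in coordinates of
  the character lattice.\<close>

lemma dunkl_op_quasi_invariants_k:
  fixes f :: "_ \<Rightarrow> ('x \<Rightarrow>\<^sub>0 'k::field_char_0) tfrac"
  assumes P: "positive_roots R P" and k: "weyl_invariant R cor P k" and \<xi>: "additive \<xi>"
    and f: "f \<in> quasi_invariants_k R cor P k"
  shows "dunkl_op R cor P k \<xi> f \<in> quasi_invariants_k R cor P k"
proof -
  interpret X: module "zscale :: int \<Rightarrow> 'x \<Rightarrow> 'x" by (rule module_zscale)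
  obtain B :: "'x set" where B: "finite B" "X.independent B" "X.span B = UNIV" using lattice by blast
  define \<eta> where "\<eta> b x = X.representation B x b" for b x
  have \<eta>: "additive (\<eta> b)" for b
    by (rule additive.intro) (simp add: \<eta>_def X.representation_add B)
  have f': "f \<in> ring_families" using f quasi_invariants_k_subset_ring_families by blast
  have additive: "additive (\<lambda>x. of_int (\<eta> b x) :: 'k)" for b using \<eta> by (simp add: additive_def)
  have sum_additive: "additive (\<lambda>x. \<Sum>b\<in>A. \<xi> b * of_int (\<eta> b x))" for A
    using additive by (simp add: additive_def distrib_left sum.distrib)
  have expand: "\<xi> x = (\<Sum>b\<in>B. \<xi> b * of_int (\<eta> b x))" for x
  proof -
    have "\<xi> x = \<xi> (\<Sum>b\<in>B. zscale (\<eta> b x) b)"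
      using X.sum_representation_eq[of B x B] B by (simp add: \<eta>_def)
    then show ?thesis
      by (simp add: additive.sum[OF \<xi>] additive_zscale_int[OF \<xi>] mult.commute)
  qed
  \<comment> \<open>Stated for an arbitrary finite index set so that induction can add one
    coordinate at a time.\<close>
  have "dunkl_op R cor P k (\<lambda>x. \<Sum>b\<in>A. \<xi> b * of_int (\<eta> b x)) f \<in> quasi_invariants_k R cor P k"
    if "finite A" for A
    using that
  proof (induction A)
    case empty
    \<comment> \<open>The empty sum is handled as the zero integral functional.\<close>
    have "dunkl_op R cor P k (\<lambda>x. of_int 0) f \<in> quasi_invariants_k R cor P k"
      by (rule dunkl_op_integral[OF P k _ f]) (simp add: additive_def)
    then show ?case by simp
  next
    case (insert b A)
    have "dunkl_op R cor P k (\<lambda>x. \<xi> b * of_int (\<eta> b x)) f \<in> quasi_invariants_k R cor P k"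
      unfolding dunkl_op_times[OF additive f']
      by (intro module.subspace_scale[OF module_kscale subspace_quasi_invariants_k]
          dunkl_op_integral[OF P k \<eta> f])
    moreover have "additive (\<lambda>x. \<xi> b * of_int (\<eta> b x))"
      using additive[of b] by (simp add: additive_def distrib_left)
    then have "dunkl_op R cor P k (\<lambda>x. \<Sum>b\<in>insert b A. \<xi> b * of_int (\<eta> b x)) f =
        dunkl_op R cor P k (\<lambda>x. \<xi> b * of_int (\<eta> b x)) f +
        dunkl_op R cor P k (\<lambda>x. \<Sum>b\<in>A. \<xi> b * of_int (\<eta> b x)) f"
      by (simp only: sum.insert[OF insert.hyps] dunkl_op_plus[OF _ sum_additive f'])
    ultimately show ?case
      using insert.IH by (simp only: module.subspace_add[OF module_kscale subspace_quasi_invariants_k])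
  qed
  from this[OF B(1)] show ?thesis unfolding expand[symmetric] .
qed

end

text \<open>Stability and linearity are proved jointly: linearity of a composition on
  \<open>N\<close> needs the inner map to preserve \<open>N\<close>.\<close>

lemma end_subalgebra_stable:
  assumes "N \<subseteq> M" and N: "module.subspace kscale N"
    and G: "\<And>a. a \<in> G \<Longrightarrow> a ` N \<subseteq> N \<and> linear_on a N"
    and "a \<in> end_subalgebra kscale M G"
  shows "a ` N \<subseteq> N \<and> linear_on a N"
proof -
  note S = N[unfolded module.subspace_def[OF module_kscale]]
  have M: "u \<in> M" if "u \<in> N" for u using assms(1) that by blast
  have scale: "kscale c (u + v) = kscale c u + kscale c v" "kscale c (kscale d u) = kscale d (kscale c u)" for c d u v
    by (simp_all add: kscale_def fun_eq_iff distrib_left mult.left_commute)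
  show ?thesis
    using assms(4)
  proof induction
    case (1 a)
    then show ?case by (rule G)
  next
    case 2
    then show ?case using M S by (simp add: linear_on_def image_subset_iff)
  next
    case (3 a b)
    then show ?case
      using M S by (simp add: linear_on_def image_subset_iff scale add.left_commute add.assoc del: plus_fun_apply)
  next
    case (4 a c)
    then show ?case using M S by (simp add: linear_on_def image_subset_iff scale)
  next
    case (5 a b)
    then show ?case using M S by (simp add: linear_on_def image_subset_iff compose_def)
  qed
qed

theorem theorem7p8:
  fixes R P :: "'x::ab_group_add set" and cor :: "'x \<Rightarrow> 'x \<Rightarrow> int" and k :: "'x \<Rightarrow> nat"
    and M QK :: "(('x \<Rightarrow> 'x) \<Rightarrow> ('x \<Rightarrow>\<^sub>0 'k::field_char_0) tfrac) set"
  assumes "root_datum R cor"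
    and "positive_roots R P"
    and "weyl_invariant R cor P k"
  defines "M \<equiv> regular_module R cor P"
    and "QK \<equiv> quasi_invariants_k R cor P k"
  shows "QK \<subseteq> M
    \<and> (\<forall>\<xi>. additive \<xi> \<longrightarrow> (\<forall>f\<in>QK. dunkl_op R cor P k \<xi> f \<in> QK))
    \<and> left_module kscale M (cherednik_algebra R cor P k) QK (\<lambda>a f. a f)
    \<and> (\<forall>p. const_family R cor p \<in> quasi_invariants R cor P k
         \<and> restrict (mult_op p) M \<in> cherednik_algebra R cor P k
         \<and> (\<forall>f\<in>QK. restrict (mult_op p) M f = (incl \<circ> const_family R cor p) * f))"
proof (intro conjI allI impI ballI)
  interpret root_datum R cor by fact
  note P = assms(2) and k = assms(3)
  show QM: "QK \<subseteq> M" unfolding QK_def M_def by (rule quasi_invariants_k_subset_regular_module)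
  show dunkl: "dunkl_op R cor P k \<xi> f \<in> QK" if "additive \<xi>" "f \<in> QK" for \<xi> f
    using that unfolding QK_def by (rule dunkl_op_quasi_invariants_k[OF P k])
  have S: "module.subspace kscale QK" unfolding QK_def by (rule subspace_quasi_invariants_k)
  have families: "QK \<subseteq> ring_families" unfolding QK_def by (rule quasi_invariants_k_subset_ring_families)
  \<comment> \<open>Restriction to \<open>M\<close> changes nothing on \<open>QK\<close>, which lies
    in \<open>M\<close> and is closed under sums and scalars.\<close>
  have restrict: "restrict T M ` QK \<subseteq> QK \<and> linear_on (restrict T M) QK"
    if "linear_on T ring_families" "\<And>f. f \<in> QK \<Longrightarrow> T f \<in> QK" for T
    using linear_on_subset[OF that(1) families] that(2) QM S[unfolded module.subspace_def[OF module_kscale]]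
    by (auto simp: linear_on_def subset_iff)
  have H: "a ` QK \<subseteq> QK \<and> linear_on a QK" if "a \<in> cherednik_algebra R cor P k" for a
  proof (rule end_subalgebra_stable[OF QM S _ that[unfolded cherednik_algebra_def, folded M_def]])
    show "a ` QK \<subseteq> QK \<and> linear_on a QK"
      if "a \<in> {restrict (mult_op p) M | p. True} \<union> {restrict (weyl_op g) M | g. g \<in> weyl_group R cor} \<union>
        {restrict (dunkl_op R cor P k \<xi>) M | \<xi>. additive \<xi>}" for a
      using that
    proof (elim UnE CollectE exE conjE; hypsubst)
      show "restrict (mult_op p) M ` QK \<subseteq> QK \<and> linear_on (restrict (mult_op p) M) QK" for p
        by (rule restrict[OF linear_on_mult_op]) (simp add: QK_def mult_op_quasi_invariants_k)
      show "restrict (weyl_op g) M ` QK \<subseteq> QK \<and> linear_on (restrict (weyl_op g) M) QK"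
        if "g \<in> weyl_group R cor" for g
        by (rule restrict[OF linear_on_weyl_op[OF that]])
          (simp add: QK_def weyl_op_quasi_invariants_k[OF P k that])
      show "restrict (dunkl_op R cor P k \<xi>) M ` QK \<subseteq> QK \<and> linear_on (restrict (dunkl_op R cor P k \<xi>) M) QK"
        if "additive \<xi>" for \<xi>
        by (rule restrict[OF linear_on_dunkl_op[OF P that]]) (rule dunkl[OF that])
    qed
  qed
  show "left_module kscale M (cherednik_algebra R cor P k) QK (\<lambda>a f. a f)"
  proof -
    have "a u \<in> QK" "a (kscale c u) = kscale c (a u)" if "a \<in> cherednik_algebra R cor P k" "u \<in> QK" for a c u
      using H[OF that(1)] that(2) by (auto simp: linear_on_def)
    moreover have "a (u + v) = a u + a v"
      if "a \<in> cherednik_algebra R cor P k" "u \<in> QK" "v \<in> QK" for a u v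
      using H[OF that(1)] that(2,3) by (simp add: linear_on_def del: plus_fun_apply)
    ultimately show ?thesis
      using S by (simp add: left_module_def compose_def subsetD[OF QM] del: plus_fun_apply)
  qed
  fix p
  show "const_family R cor p \<in> quasi_invariants R cor P k"
    using positive_roots_subset[OF P]
    by (auto simp: quasi_invariants_def const_family_def weyl_group.weyl_reflection)
  show "restrict (mult_op p) M \<in> cherednik_algebra R cor P k"
    unfolding cherednik_algebra_def M_def[symmetric] by (rule end_subalgebra.intros) blast
  \<comment> \<open>Off the Weyl group the constant family vanishes, so the two sides agree there
    because \<open>f\<close> vanishes too.\<close>
  show "restrict (mult_op p) M f = (incl \<circ> const_family R cor p) * f" if "f \<in> QK" for f
    using that QM quasi_invariants_k_eq_0[of f R cor P k]
    by (auto simp: QK_def mult_op_def const_family_def fun_eq_iff times_fun_def incl_0)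
qed

end
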